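(* Let $H$ be a subgroup of a finite group $G$. Given an $H$-global $G$-partial representation $\pi\colon G\to\operatorname{End}(V)$, there exists a unique morphism of $\mathbb{C}$-algebras $\phi_\pi\colon\mathbb{C}^H_{par}G\to\operatorname{End}(V)$ such that $\phi_\pi([g])=\pi(g)$ for all $g\in G$; this makes $V$ into a left $\mathbb{C}^H_{par}G$-module. Conversely, given any left $\mathbb{C}^H_{par}G$-module $V$ with action $\mu\colon\mathbb{C}^H_{par}G\times V\to V$, the assignment $$\pi_\mu\colon G\to\operatorname{End}(V),\qquad g\mapsto\left[v\mapsto\mu([g],v)\right]$$ is an $H$-global $G$-partial representation. These correspondences induce an isomorphism of categories $\Phi\colon\mathsf{PRep}_G^H\to\mathbb{C}^H_{par}G\text{-}\mathsf{Mod}$ between the category $\mathsf{PRep}_G^H$ of $H$-global $G$-partial representations and the category $\mathbb{C}^H_{par}G\text{-}\mathsf{Mod}$ of left $\mathbb{C}^H_{par}G$-modules.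
   Context: All groups are finite and all vector spaces carrying representations (and modules) are finite-dimensional over $\mathbb{C}$. A $G$-partial representation $(V,\pi)$ on a vector space $V$ is a map $\pi\colon G\to\operatorname{End}(V)$ such that for all $g,h\in G$: $\pi(1_G)=\mathrm{Id}_V$; $\pi(g^{-1})\pi(gh)=\pi(g^{-1})\pi(g)\pi(h)$; $\pi(gh)\pi(h^{-1})=\pi(g)\pi(h)\pi(h^{-1})$. It is $H$-global if the restriction of $\pi$ to $H$ is a (usual) representation of $H$. A morphism $(V,\pi)\to(V',\pi')$ is a linear map $f\colon V\to V'$ with $f\circ\pi(g)=\pi'(g)\circ f$ for all $g\in G$. $\mathbb{C}^H_{par}G$ is the associative unital $\mathbb{C}$-algebra generated by the symbols $\{[g]\mid g\in G\}$ subject to the relations, for all $g,g'\in G$ and $h\in H$: $[1_G][g]=[g][1_G]=[g]$; $[g^{-1}][g][g']=[g^{-1}][gg']$; $[g'][g][g^{-1}]=[g'g][g^{-1}]$; $[h][h^{-1}]=[1_G]$. Its unit is $[1_G]$. *)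

theory Defs
  imports "HOL-Algebra.Algebra" "HOL-Algebra.Algebraic_Closure_Type" "HOL.Complex"
begin

section \<open>Finite-dimensional complex vector spaces\<close>

text \<open>
  Vector spaces are \<open>module\<close> records over the field of complex numbers; the multiplicative
  fields \<open>mult\<close> and \<open>one\<close> of such a record are ignored unless it stands for an algebra.
  Functions are taken to be extensional (undefined outside their domain), so that equality in HOL
  is equality of functions on their domains.
\<close>

abbreviation complex_field :: "complex ring" where
  "complex_field \<equiv> ring_of_type_algebra"

definition fd_vector_space :: "(complex, 'v) module \<Rightarrow> bool" where
  "fd_vector_space V \<longleftrightarrow> module complex_field V \<and>
     (\<exists>S. finite S \<and> S \<subseteq> carrier V \<and>
        (\<forall>v\<in>carrier V. \<exists>c. v = (\<Oplus>\<^bsub>V\<^esub>s\<in>S. c s \<odot>\<^bsub>V\<^esub> s)))"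

definition lin_hom :: "(complex, 'v) module \<Rightarrow> (complex, 'w) module \<Rightarrow> ('v \<Rightarrow> 'w) set" where
  "lin_hom V W = {f \<in> carrier V \<rightarrow>\<^sub>E carrier W.
     (\<forall>x\<in>carrier V. \<forall>y\<in>carrier V. f (x \<oplus>\<^bsub>V\<^esub> y) = f x \<oplus>\<^bsub>W\<^esub> f y) \<and>
     (\<forall>c. \<forall>x\<in>carrier V. f (c \<odot>\<^bsub>V\<^esub> x) = c \<odot>\<^bsub>W\<^esub> f x)}"

definition End_alg :: "(complex, 'v) module \<Rightarrow> (complex, 'v \<Rightarrow> 'v) module" where
  "End_alg V = \<lparr>carrier = lin_hom V V,
     monoid.mult = compose (carrier V),
     monoid.one = (\<lambda>v\<in>carrier V. v),
     ring.zero = (\<lambda>v\<in>carrier V. \<zero>\<^bsub>V\<^esub>),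
     add = (\<lambda>f g. \<lambda>v\<in>carrier V. f v \<oplus>\<^bsub>V\<^esub> g v),
     module.smult = (\<lambda>c f. \<lambda>v\<in>carrier V. c \<odot>\<^bsub>V\<^esub> f v)\<rparr>"

definition alg_hom :: "(complex, 'a) module \<Rightarrow> (complex, 'b) module \<Rightarrow> ('a \<Rightarrow> 'b) set" where
  "alg_hom A B = {h \<in> ring_hom A B. h \<in> extensional (carrier A) \<and>
     (\<forall>c. \<forall>x\<in>carrier A. h (c \<odot>\<^bsub>A\<^esub> x) = c \<odot>\<^bsub>B\<^esub> h x)}"


section \<open>The algebra given by generators and relations\<close>

text \<open>
  The free unital associative algebra on \<open>S\<close>: finitely supported coefficient functions on the words
  over \<open>S\<close>. The unit is the empty word; a product of two words is their concatenation, so the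
  coefficient of \<open>w\<close> in \<open>p q\<close> is summed over all ways of cutting \<open>w\<close> in two.
\<close>

definition free_algebra :: "'g set \<Rightarrow> (complex, 'g list \<Rightarrow> complex) module" where
  "free_algebra S = \<lparr>carrier = {p. finite {w. p w \<noteq> 0} \<and> {w. p w \<noteq> 0} \<subseteq> lists S},
     monoid.mult = (\<lambda>p q w. \<Sum>i\<le>length w. p (take i w) * q (drop i w)),
     monoid.one = (\<lambda>w. if w = [] then 1 else 0),
     ring.zero = (\<lambda>w. 0),
     add = (\<lambda>p q w. p w + q w),
     module.smult = (\<lambda>c p w. c * p w)\<rparr>"

definition free_gen :: "'g \<Rightarrow> 'g list \<Rightarrow> complex" where
  "free_gen g = (\<lambda>w. if w = [g] then 1 else 0)"

definition quot_algebra :: "(complex, 'a) module \<Rightarrow> 'a set \<Rightarrow> (complex, 'a set) module" where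
  "quot_algebra A I = \<lparr>carrier = carrier (A Quot I),
     monoid.mult = monoid.mult (A Quot I),
     monoid.one = monoid.one (A Quot I),
     ring.zero = ring.zero (A Quot I),
     add = ring.add (A Quot I),
     module.smult = (\<lambda>c K. \<Union>x\<in>K. I +>\<^bsub>A\<^esub> (c \<odot>\<^bsub>A\<^esub> x))\<rparr>"

text \<open>
  The first relator identifies the generator of the neutral element with the unit of the algebra;
  the remaining ones alone would leave the unit of the unital free algebra apart from it.
\<close>

definition par_relators :: "('g, 'b) monoid_scheme \<Rightarrow> 'g set \<Rightarrow> ('g list \<Rightarrow> complex) set" where
  "par_relators G H = (let F = free_algebra (carrier G); e = free_gen in
     {e \<one>\<^bsub>G\<^esub> \<ominus>\<^bsub>F\<^esub> \<one>\<^bsub>F\<^esub>}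
     \<union> (\<Union>g\<in>carrier G. {e \<one>\<^bsub>G\<^esub> \<otimes>\<^bsub>F\<^esub> e g \<ominus>\<^bsub>F\<^esub> e g, e g \<otimes>\<^bsub>F\<^esub> e \<one>\<^bsub>G\<^esub> \<ominus>\<^bsub>F\<^esub> e g})
     \<union> (\<Union>g\<in>carrier G. \<Union>k\<in>carrier G.
          {e (inv\<^bsub>G\<^esub> g) \<otimes>\<^bsub>F\<^esub> e g \<otimes>\<^bsub>F\<^esub> e k \<ominus>\<^bsub>F\<^esub> e (inv\<^bsub>G\<^esub> g) \<otimes>\<^bsub>F\<^esub> e (g \<otimes>\<^bsub>G\<^esub> k),
           e k \<otimes>\<^bsub>F\<^esub> e g \<otimes>\<^bsub>F\<^esub> e (inv\<^bsub>G\<^esub> g) \<ominus>\<^bsub>F\<^esub> e (k \<otimes>\<^bsub>G\<^esub> g) \<otimes>\<^bsub>F\<^esub> e (inv\<^bsub>G\<^esub> g)})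
     \<union> (\<Union>h\<in>H. {e h \<otimes>\<^bsub>F\<^esub> e (inv\<^bsub>G\<^esub> h) \<ominus>\<^bsub>F\<^esub> e \<one>\<^bsub>G\<^esub>}))"

definition par_ideal :: "('g, 'b) monoid_scheme \<Rightarrow> 'g set \<Rightarrow> ('g list \<Rightarrow> complex) set" where
  "par_ideal G H = Idl\<^bsub>free_algebra (carrier G)\<^esub> (par_relators G H)"

definition par_algebra ::
    "('g, 'b) monoid_scheme \<Rightarrow> 'g set \<Rightarrow> (complex, ('g list \<Rightarrow> complex) set) module" where
  "par_algebra G H = quot_algebra (free_algebra (carrier G)) (par_ideal G H)"

definition par_gen :: "('g, 'b) monoid_scheme \<Rightarrow> 'g set \<Rightarrow> 'g \<Rightarrow> ('g list \<Rightarrow> complex) set" where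
  "par_gen G H g = par_ideal G H +>\<^bsub>free_algebra (carrier G)\<^esub> free_gen g"


section \<open>Partial representations and modules over an algebra\<close>

definition partial_rep ::
    "('g, 'b) monoid_scheme \<Rightarrow> (complex, 'v) module \<Rightarrow> ('g \<Rightarrow> 'v \<Rightarrow> 'v) \<Rightarrow> bool" where
  "partial_rep G V \<pi> \<longleftrightarrow> fd_vector_space V \<and>
     \<pi> \<in> carrier G \<rightarrow>\<^sub>E carrier (End_alg V) \<and>
     \<pi> \<one>\<^bsub>G\<^esub> = \<one>\<^bsub>End_alg V\<^esub> \<and>
     (\<forall>g\<in>carrier G. \<forall>h\<in>carrier G.
        \<pi> (inv\<^bsub>G\<^esub> g) \<otimes>\<^bsub>End_alg V\<^esub> \<pi> (g \<otimes>\<^bsub>G\<^esub> h) =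
          \<pi> (inv\<^bsub>G\<^esub> g) \<otimes>\<^bsub>End_alg V\<^esub> \<pi> g \<otimes>\<^bsub>End_alg V\<^esub> \<pi> h \<and>
        \<pi> (g \<otimes>\<^bsub>G\<^esub> h) \<otimes>\<^bsub>End_alg V\<^esub> \<pi> (inv\<^bsub>G\<^esub> h) =
          \<pi> g \<otimes>\<^bsub>End_alg V\<^esub> \<pi> h \<otimes>\<^bsub>End_alg V\<^esub> \<pi> (inv\<^bsub>G\<^esub> h))"

text \<open>The units of \<open>End_alg V\<close> form the general linear group of \<open>V\<close>.\<close>

definition global_partial_rep ::
    "('g, 'b) monoid_scheme \<Rightarrow> 'g set \<Rightarrow> (complex, 'v) module \<Rightarrow> ('g \<Rightarrow> 'v \<Rightarrow> 'v) \<Rightarrow> bool" where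
  "global_partial_rep G H V \<pi> \<longleftrightarrow> partial_rep G V \<pi> \<and>
     restrict \<pi> H \<in> hom (G\<lparr>carrier := H\<rparr>) (units_of (End_alg V))"

definition left_module ::
    "(complex, 'a) module \<Rightarrow> (complex, 'v) module \<Rightarrow> ('a \<times> 'v \<Rightarrow> 'v) \<Rightarrow> bool" where
  "left_module A V \<mu> \<longleftrightarrow> fd_vector_space V \<and>
     \<mu> \<in> carrier A \<times> carrier V \<rightarrow>\<^sub>E carrier V \<and>
     (\<forall>a\<in>carrier A. \<forall>v\<in>carrier V. \<forall>w\<in>carrier V.
        \<mu> (a, v \<oplus>\<^bsub>V\<^esub> w) = \<mu> (a, v) \<oplus>\<^bsub>V\<^esub> \<mu> (a, w)) \<and>
     (\<forall>a\<in>carrier A. \<forall>b\<in>carrier A. \<forall>v\<in>carrier V.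
        \<mu> (a \<oplus>\<^bsub>A\<^esub> b, v) = \<mu> (a, v) \<oplus>\<^bsub>V\<^esub> \<mu> (b, v)) \<and>
     (\<forall>c. \<forall>a\<in>carrier A. \<forall>v\<in>carrier V.
        \<mu> (c \<odot>\<^bsub>A\<^esub> a, v) = c \<odot>\<^bsub>V\<^esub> \<mu> (a, v) \<and> \<mu> (a, c \<odot>\<^bsub>V\<^esub> v) = c \<odot>\<^bsub>V\<^esub> \<mu> (a, v)) \<and>
     (\<forall>a\<in>carrier A. \<forall>b\<in>carrier A. \<forall>v\<in>carrier V. \<mu> (a \<otimes>\<^bsub>A\<^esub> b, v) = \<mu> (a, \<mu> (b, v))) \<and>
     (\<forall>v\<in>carrier V. \<mu> (\<one>\<^bsub>A\<^esub>, v) = v)"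

definition phi_of :: "('g, 'b) monoid_scheme \<Rightarrow> 'g set \<Rightarrow> (complex, 'v) module \<Rightarrow>
    ('g \<Rightarrow> 'v \<Rightarrow> 'v) \<Rightarrow> ('g list \<Rightarrow> complex) set \<Rightarrow> 'v \<Rightarrow> 'v" where
  "phi_of G H V \<pi> = (THE \<phi>. \<phi> \<in> alg_hom (par_algebra G H) (End_alg V) \<and>
     (\<forall>g\<in>carrier G. \<phi> (par_gen G H g) = \<pi> g))"

definition action_of :: "('g, 'b) monoid_scheme \<Rightarrow> 'g set \<Rightarrow> (complex, 'v) module \<Rightarrow>
    ('g \<Rightarrow> 'v \<Rightarrow> 'v) \<Rightarrow> ('g list \<Rightarrow> complex) set \<times> 'v \<Rightarrow> 'v" where
  "action_of G H V \<pi> = (\<lambda>(a, v)\<in>carrier (par_algebra G H) \<times> carrier V. phi_of G H V \<pi> a v)"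

definition rep_of :: "('g, 'b) monoid_scheme \<Rightarrow> 'g set \<Rightarrow> (complex, 'v) module \<Rightarrow>
    (('g list \<Rightarrow> complex) set \<times> 'v \<Rightarrow> 'v) \<Rightarrow> 'g \<Rightarrow> 'v \<Rightarrow> 'v" where
  "rep_of G H V \<mu> = (\<lambda>g\<in>carrier G. \<lambda>v\<in>carrier V. \<mu> (par_gen G H g, v))"


section \<open>Categories\<close>

text \<open>
  Hom-sets are indexed by pairs of objects and need not be disjoint; accordingly the composition
  and the action of a functor on morphisms take the objects involved as arguments.
\<close>

record ('o, 'm) category =
  cat_obj :: "'o set"
  cat_hom :: "'o \<Rightarrow> 'o \<Rightarrow> 'm set"
  cat_id :: "'o \<Rightarrow> 'm"
  cat_comp :: "'o \<Rightarrow> 'o \<Rightarrow> 'o \<Rightarrow> 'm \<Rightarrow> 'm \<Rightarrow> 'm"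

locale category =
  fixes C :: "('o, 'm) category"
  assumes id_in_hom: "x \<in> cat_obj C \<Longrightarrow> cat_id C x \<in> cat_hom C x x"
    and comp_in_hom: "\<lbrakk>x \<in> cat_obj C; y \<in> cat_obj C; z \<in> cat_obj C;
      f \<in> cat_hom C x y; g \<in> cat_hom C y z\<rbrakk> \<Longrightarrow> cat_comp C x y z g f \<in> cat_hom C x z"
    and comp_id_left: "\<lbrakk>x \<in> cat_obj C; y \<in> cat_obj C; f \<in> cat_hom C x y\<rbrakk> \<Longrightarrow>
      cat_comp C x y y (cat_id C y) f = f"
    and comp_id_right: "\<lbrakk>x \<in> cat_obj C; y \<in> cat_obj C; f \<in> cat_hom C x y\<rbrakk> \<Longrightarrow>
      cat_comp C x x y f (cat_id C x) = f"
    and comp_assoc: "\<lbrakk>w \<in> cat_obj C; x \<in> cat_obj C; y \<in> cat_obj C; z \<in> cat_obj C;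
      f \<in> cat_hom C w x; g \<in> cat_hom C x y; h \<in> cat_hom C y z\<rbrakk> \<Longrightarrow>
      cat_comp C w y z h (cat_comp C w x y g f) = cat_comp C w x z (cat_comp C x y z h g) f"

record ('o, 'm, 'p, 'n) cat_functor =
  on_obj :: "'o \<Rightarrow> 'p"
  on_hom :: "'o \<Rightarrow> 'o \<Rightarrow> 'm \<Rightarrow> 'n"

locale is_functor = C: category C + D: category D
  for C :: "('o, 'm) category" and D :: "('p, 'n) category" +
  fixes F :: "('o, 'm, 'p, 'n) cat_functor"
  assumes on_obj_closed: "x \<in> cat_obj C \<Longrightarrow> on_obj F x \<in> cat_obj D"
    and on_hom_closed: "\<lbrakk>x \<in> cat_obj C; y \<in> cat_obj C; f \<in> cat_hom C x y\<rbrakk> \<Longrightarrow>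
      on_hom F x y f \<in> cat_hom D (on_obj F x) (on_obj F y)"
    and on_hom_id: "x \<in> cat_obj C \<Longrightarrow> on_hom F x x (cat_id C x) = cat_id D (on_obj F x)"
    and on_hom_comp: "\<lbrakk>x \<in> cat_obj C; y \<in> cat_obj C; z \<in> cat_obj C;
      f \<in> cat_hom C x y; g \<in> cat_hom C y z\<rbrakk> \<Longrightarrow>
      on_hom F x z (cat_comp C x y z g f) =
        cat_comp D (on_obj F x) (on_obj F y) (on_obj F z) (on_hom F y z g) (on_hom F x y f)"

text \<open>The composite of \<open>F'\<close> after \<open>F\<close> is equal (not just isomorphic) to the identity functor of \<open>C\<close>.\<close>

definition retracts_functor :: "('o, 'm) category \<Rightarrow> ('o, 'm, 'p, 'n) cat_functor \<Rightarrow>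
    ('p, 'n, 'o, 'm) cat_functor \<Rightarrow> bool" where
  "retracts_functor C F F' \<longleftrightarrow>
     (\<forall>x\<in>cat_obj C. on_obj F' (on_obj F x) = x) \<and>
     (\<forall>x\<in>cat_obj C. \<forall>y\<in>cat_obj C. \<forall>f\<in>cat_hom C x y.
        on_hom F' (on_obj F x) (on_obj F y) (on_hom F x y f) = f)"

definition inverse_isomorphisms :: "('o, 'm) category \<Rightarrow> ('p, 'n) category \<Rightarrow>
    ('o, 'm, 'p, 'n) cat_functor \<Rightarrow> ('p, 'n, 'o, 'm) cat_functor \<Rightarrow> bool" where
  "inverse_isomorphisms C D F F' \<longleftrightarrow> is_functor C D F \<and> is_functor D C F' \<and>
     retracts_functor C F F' \<and> retracts_functor D F' F"

text \<open>
  The objects of the next two categories are the structures whose underlying set consists of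
  elements of the type \<open>'v\<close>, which is arbitrary and plays the role of a universe.
\<close>

definition PRep :: "('g, 'b) monoid_scheme \<Rightarrow> 'g set \<Rightarrow>
    ((complex, 'v) module \<times> ('g \<Rightarrow> 'v \<Rightarrow> 'v), 'v \<Rightarrow> 'v) category" where
  "PRep G H = \<lparr>cat_obj = {(V, \<pi>). global_partial_rep G H V \<pi>},
     cat_hom = (\<lambda>(V, \<pi>) (V', \<pi>'). {f \<in> lin_hom V V'.
       \<forall>g\<in>carrier G. compose (carrier V) f (\<pi> g) = compose (carrier V) (\<pi>' g) f}),
     cat_id = (\<lambda>(V, \<pi>). \<lambda>v\<in>carrier V. v),
     cat_comp = (\<lambda>(V, \<pi>) y z g f. compose (carrier V) g f)\<rparr>"

definition Left_Mod :: "(complex, 'a) module \<Rightarrow>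
    ((complex, 'v) module \<times> ('a \<times> 'v \<Rightarrow> 'v), 'v \<Rightarrow> 'v) category" where
  "Left_Mod A = \<lparr>cat_obj = {(V, \<mu>). left_module A V \<mu>},
     cat_hom = (\<lambda>(V, \<mu>) (V', \<mu>'). {f \<in> lin_hom V V'.
       \<forall>a\<in>carrier A. \<forall>v\<in>carrier V. f (\<mu> (a, v)) = \<mu>' (a, f v)}),
     cat_id = (\<lambda>(V, \<mu>). \<lambda>v\<in>carrier V. v),
     cat_comp = (\<lambda>(V, \<mu>) y z g f. compose (carrier V) g f)\<rparr>"

definition Phi_functor :: "('g, 'b) monoid_scheme \<Rightarrow> 'g set \<Rightarrow>
    ((complex, 'v) module \<times> ('g \<Rightarrow> 'v \<Rightarrow> 'v), 'v \<Rightarrow> 'v,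
     (complex, 'v) module \<times> (('g list \<Rightarrow> complex) set \<times> 'v \<Rightarrow> 'v), 'v \<Rightarrow> 'v) cat_functor" where
  "Phi_functor G H = \<lparr>on_obj = (\<lambda>(V, \<pi>). (V, action_of G H V \<pi>)), on_hom = (\<lambda>x y f. f)\<rparr>"

definition Psi_functor :: "('g, 'b) monoid_scheme \<Rightarrow> 'g set \<Rightarrow>
    ((complex, 'v) module \<times> (('g list \<Rightarrow> complex) set \<times> 'v \<Rightarrow> 'v), 'v \<Rightarrow> 'v,
     (complex, 'v) module \<times> ('g \<Rightarrow> 'v \<Rightarrow> 'v), 'v \<Rightarrow> 'v) cat_functor" where
  "Psi_functor G H = \<lparr>on_obj = (\<lambda>(V, \<mu>). (V, rep_of G H V \<mu>)), on_hom = (\<lambda>x y f. f)\<rparr>"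

end

theory Submission
  imports Defs
begin

text \<open>
  A map from \<open>G\<close> to an algebra \<open>B\<close> extends uniquely to the free algebra, and the extension descends to
  the quotient exactly if the map satisfies the defining relations. For \<open>B = End V\<close>, these relations
  say that the map is an \<open>H\<close>-global partial representation: given the partial representation axioms,
  being multiplicative on \<open>H\<close> is equivalent to \<open>\<pi> h \<circ> \<pi> (h\<inverse>) = id\<close> for \<open>h \<in> H\<close>. Since the algebra is generated
  by the classes of the elements of \<open>G\<close>, a linear map intertwines two representations iff it
  is linear over the algebra.
\<close>

section \<open>The free algebra\<close>

text \<open>Both correspondences pass through a third notion, algebra homomorphisms from
  \<open>par_algebra G H\<close> to \<open>End_alg V\<close>. Currying identifies them with module
  structures on \<open>V\<close>; evaluation at the classes \<open>par_gen G H g\<close> identifies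
  them with the maps satisfying the relations. Since \<open>phi_of\<close> is a definite
  description, it can be computed with only after existence and uniqueness are established;
  uniqueness is then also what recovers a module structure from its representation. The functors are
  inverse on the nose, not merely up to natural isomorphism, because both keep the underlying space
  and every linear map, and because representations, actions and linear maps are extensional, so
  that agreement on carriers is equality. For morphisms there remains one claim: corresponding pairs
  of objects have the same hom-set.\<close>

lemma complex_field_simps [simp]:
  "carrier complex_field = UNIV" "a \<oplus>\<^bsub>complex_field\<^esub> b = a + b" "a \<otimes>\<^bsub>complex_field\<^esub> b = a * b"
  "\<zero>\<^bsub>complex_field\<^esub> = 0" "\<one>\<^bsub>complex_field\<^esub> = 1"
  by (simp_all add: ring_of_type_algebra_def)

text \<open>Ring and vector space share the carrier and the addition of one record. The product need
  not commute, so compatibility with scalars is required in each factor separately.\<close>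

locale complex_algebra = ring A + V: module complex_field A for A :: "(complex, 'a) module" (structure) +
  assumes smult_mult_left: "\<lbrakk>x \<in> carrier A; y \<in> carrier A\<rbrakk> \<Longrightarrow> (c \<odot> x) \<otimes> y = c \<odot> (x \<otimes> y)"
    and smult_mult_right: "\<lbrakk>x \<in> carrier A; y \<in> carrier A\<rbrakk> \<Longrightarrow> x \<otimes> (c \<odot> y) = c \<odot> (x \<otimes> y)"

text \<open>Scaling by \<open>c\<close> is multiplication by the ring element
  \<open>c \<odot> \<one>\<close>. Hence an ideal in the ring sense is a subspace, and the quotient
  by it inherits scalars.\<close>

lemma (in complex_algebra) ideal_smult_closed:
  assumes "ideal I A" "x \<in> I" shows "c \<odot> x \<in> I"
proof -
  interpret I: ideal I A by fact
  have x: "x \<in> carrier A" using assms(2) by (rule I.a_Hcarr)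
  have "(c \<odot> \<one>) \<otimes> x \<in> I" using assms(2) x by (intro I.I_l_closed) auto
  then show ?thesis using x smult_mult_left[of \<one> x c] by simp
qed

text \<open>These indicator functions are the standard basis of the free algebra; the unit and the
  generators are the words of length 0 and 1.\<close>

definition monomial :: "'g list \<Rightarrow> 'g list \<Rightarrow> complex" where
  "monomial w = (\<lambda>x. if x = w then 1 else 0)"

lemma free_gen_eq_monomial: "free_gen g = monomial [g]"
  by (simp add: free_gen_def monomial_def)

lemma free_algebra_simps:
  "p \<in> carrier (free_algebra S) \<longleftrightarrow> finite {w. p w \<noteq> 0} \<and> {w. p w \<noteq> 0} \<subseteq> lists S"
  "p \<otimes>\<^bsub>free_algebra S\<^esub> q = (\<lambda>w. \<Sum>i\<le>length w. p (take i w) * q (drop i w))"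
  "\<one>\<^bsub>free_algebra S\<^esub> = monomial []"
  "\<zero>\<^bsub>free_algebra S\<^esub> = (\<lambda>w. 0)"
  "p \<oplus>\<^bsub>free_algebra S\<^esub> q = (\<lambda>w. p w + q w)"
  "c \<odot>\<^bsub>free_algebra S\<^esub> p = (\<lambda>w. c * p w)"
  by (simp_all add: free_algebra_def monomial_def)

lemma monomial_closed: "w \<in> lists S \<Longrightarrow> monomial w \<in> carrier (free_algebra S)"
  by (simp add: free_algebra_simps monomial_def)

lemma free_gen_closed: "g \<in> S \<Longrightarrow> free_gen g \<in> carrier (free_algebra S)"
  by (simp add: free_gen_eq_monomial monomial_closed)

lemma free_add_closed:
  assumes "p \<in> carrier (free_algebra S)" "q \<in> carrier (free_algebra S)"
  shows "p \<oplus>\<^bsub>free_algebra S\<^esub> q \<in> carrier (free_algebra S)"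
proof -
  have "{w. p w + q w \<noteq> 0} \<subseteq> {w. p w \<noteq> 0} \<union> {w. q w \<noteq> 0}" by auto
  then show ?thesis using assms unfolding free_algebra_simps
    by (meson finite_UnI finite_subset le_sup_iff subset_trans)
qed

lemma free_smult_closed:
  assumes "p \<in> carrier (free_algebra S)"
  shows "c \<odot>\<^bsub>free_algebra S\<^esub> p \<in> carrier (free_algebra S)"
proof -
  have "{w. c * p w \<noteq> 0} \<subseteq> {w. p w \<noteq> 0}" by auto
  then show ?thesis using assms unfolding free_algebra_simps
    by (meson finite_subset subset_trans)
qed

text \<open>A word with nonzero coefficient in the product is a concatenation of two words from the
  finite supports of the factors.\<close>

lemma free_mult_closed:
  assumes "p \<in> carrier (free_algebra S)" "q \<in> carrier (free_algebra S)"
  shows "p \<otimes>\<^bsub>free_algebra S\<^esub> q \<in> carrier (free_algebra S)"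
proof -
  let ?P = "{w. p w \<noteq> 0}" and ?Q = "{w. q w \<noteq> 0}"
  have "{w. (\<Sum>i\<le>length w. p (take i w) * q (drop i w)) \<noteq> 0} \<subseteq> (\<lambda>(u, v). u @ v) ` (?P \<times> ?Q)"
  proof
    fix w assume "w \<in> {w. (\<Sum>i\<le>length w. p (take i w) * q (drop i w)) \<noteq> 0}"
    then obtain i where "p (take i w) * q (drop i w) \<noteq> 0"
      by (metis (mono_tags, lifting) mem_Collect_eq sum.neutral)
    then have "(take i w, drop i w) \<in> ?P \<times> ?Q" by simp
    then show "w \<in> (\<lambda>(u, v). u @ v) ` (?P \<times> ?Q)" by (rule rev_image_eqI) simp
  qed
  moreover have "finite ((\<lambda>(u, v). u @ v) ` (?P \<times> ?Q))"
    "(\<lambda>(u, v). u @ v) ` (?P \<times> ?Q) \<subseteq> lists S"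
    using assms by (fastforce simp: free_algebra_simps)+
  ultimately show ?thesis unfolding free_algebra_simps
    by (meson finite_subset subset_trans)
qed

text \<open>Both sides sum over the ways of cutting \<open>w\<close> into three pieces. The left
  side records the two cut positions \<open>j \<le> i\<close>, the right side the lengths
  \<open>j\<close> and \<open>k\<close> of the first two pieces; the substitution is
  \<open>k = i - j\<close>.\<close>

lemma free_mult_assoc:
  "(p \<otimes>\<^bsub>free_algebra S\<^esub> q) \<otimes>\<^bsub>free_algebra S\<^esub> r = p \<otimes>\<^bsub>free_algebra S\<^esub> (q \<otimes>\<^bsub>free_algebra S\<^esub> r)"
proof
  fix w :: "'a list"
  let ?n = "length w"
  let ?f = "\<lambda>j k. p (take j w) * q (take k (drop j w)) * r (drop (j + k) w)"
  have "((p \<otimes>\<^bsub>free_algebra S\<^esub> q) \<otimes>\<^bsub>free_algebra S\<^esub> r) w = (\<Sum>i\<le>?n. \<Sum>j\<le>i. ?f j (i - j))"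
    by (auto simp: free_algebra_simps sum_distrib_right drop_take min_def intro!: sum.cong)
  also have "\<dots> = (\<Sum>(i, j)\<in>(SIGMA i:{..?n}. {..i}). ?f j (i - j))"
    by (subst sum.Sigma) auto
  also have "\<dots> = (\<Sum>(j, k)\<in>(SIGMA j:{..?n}. {..?n - j}). ?f j k)"
    by (rule sum.reindex_bij_witness[where i = "\<lambda>(j, k). (j + k, j)" and j = "\<lambda>(i, j). (j, i - j)"]) auto
  also have "\<dots> = (\<Sum>j\<le>?n. \<Sum>k\<le>?n - j. ?f j k)"
    by (subst sum.Sigma) auto
  also have "\<dots> = (p \<otimes>\<^bsub>free_algebra S\<^esub> (q \<otimes>\<^bsub>free_algebra S\<^esub> r)) w"
    by (auto simp: free_algebra_simps sum_distrib_left add.commute mult.assoc intro!: sum.cong)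
  finally show "((p \<otimes>\<^bsub>free_algebra S\<^esub> q) \<otimes>\<^bsub>free_algebra S\<^esub> r) w =
    (p \<otimes>\<^bsub>free_algebra S\<^esub> (q \<otimes>\<^bsub>free_algebra S\<^esub> r)) w" .
qed

lemma monomial_mult: "monomial u \<otimes>\<^bsub>free_algebra S\<^esub> monomial v = monomial (u @ v)"
proof
  fix w
  have "(\<Sum>i\<le>length w. monomial u (take i w) * monomial v (drop i w)) =
    (\<Sum>i\<le>length w. if i = length u then monomial (u @ v) w else 0)"
  proof (rule sum.cong)
    fix i assume "i \<in> {..length w}"
    \<comment> \<open>The bound on \<open>i\<close> matters: beyond the length of \<open>w\<close>,
      \<open>take i w\<close> no longer determines \<open>i\<close>.\<close>
    then have iff: "take i w = u \<and> drop i w = v \<longleftrightarrow> i = length u \<and> w = u @ v"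
      by (metis append_eq_conv_conj append_take_drop_id atMost_iff length_take min.absorb2)
    have "monomial u (take i w) * monomial v (drop i w) =
      (if take i w = u \<and> drop i w = v then 1 else 0)"
      by (simp add: monomial_def)
    then show "monomial u (take i w) * monomial v (drop i w) =
      (if i = length u then monomial (u @ v) w else 0)"
      unfolding iff by (simp add: monomial_def)
  qed simp
  also have "\<dots> = monomial (u @ v) w"
    by (auto simp: monomial_def)
  finally show "(monomial u \<otimes>\<^bsub>free_algebra S\<^esub> monomial v) w = monomial (u @ v) w"
    by (simp add: free_algebra_simps)
qed

lemma free_algebra_abelian_group: "abelian_group (free_algebra S)"
proof (rule abelian_groupI)
  fix p assume p: "p \<in> carrier (free_algebra S)"
  show "\<exists>q\<in>carrier (free_algebra S). q \<oplus>\<^bsub>free_algebra S\<^esub> p = \<zero>\<^bsub>free_algebra S\<^esub>"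
    using free_smult_closed[OF p, of "-1"] by (rule bexI[rotated]) (simp add: free_algebra_simps)
qed (simp_all add: free_add_closed, simp_all add: free_algebra_simps add_ac)

lemma free_algebra_complex_algebra: "complex_algebra (free_algebra S)"
proof -
  have one: "monomial [] \<otimes>\<^bsub>free_algebra S\<^esub> p = p" "p \<otimes>\<^bsub>free_algebra S\<^esub> monomial [] = p" for p
  proof -
    have "(\<Sum>i\<le>length w. monomial [] (take i w) * p (drop i w)) = (\<Sum>i\<le>length w. if i = 0 then p w else 0)"
      "(\<Sum>i\<le>length w. p (take i w) * monomial [] (drop i w)) = (\<Sum>i\<le>length w. if i = length w then p w else 0)" for w
      by (rule sum.cong; auto simp: monomial_def)+
    then show "monomial [] \<otimes>\<^bsub>free_algebra S\<^esub> p = p" "p \<otimes>\<^bsub>free_algebra S\<^esub> monomial [] = p"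
      by (simp_all add: free_algebra_simps)
  qed
  have monoid: "Group.monoid (free_algebra S)"
    by (rule monoidI) (simp_all add: free_mult_closed free_mult_assoc one free_algebra_simps(3) monomial_closed)
  have "ring (free_algebra S)"
    by (rule ringI) (simp_all add: free_algebra_abelian_group monoid,
      simp_all add: free_algebra_simps distrib_left distrib_right sum.distrib)
  moreover have "module complex_field (free_algebra S)"
    by (rule moduleI) (simp_all add: cring_from_type_algebra free_algebra_abelian_group free_smult_closed,
      simp_all add: free_algebra_simps distrib_left distrib_right mult.assoc)
  ultimately show ?thesis
    by (intro complex_algebra.intro complex_algebra_axioms.intro)
      (simp_all add: free_algebra_simps sum_distrib_left mult_ac)
qed

lemma free_algebra_induct [consumes 1, case_names monomial add smult]:
  assumes "p \<in> carrier (free_algebra S)"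
    and monomial: "\<And>w. w \<in> lists S \<Longrightarrow> P (monomial w)"
    and add: "\<And>p q. \<lbrakk>p \<in> carrier (free_algebra S); q \<in> carrier (free_algebra S); P p; P q\<rbrakk> \<Longrightarrow>
      P (p \<oplus>\<^bsub>free_algebra S\<^esub> q)"
    and smult: "\<And>c p. \<lbrakk>p \<in> carrier (free_algebra S); P p\<rbrakk> \<Longrightarrow> P (c \<odot>\<^bsub>free_algebra S\<^esub> p)"
  shows "P p"
proof -
  \<comment> \<open>\<open>T\<close> merely contains the support, so that the induction hypothesis
    still applies after one coefficient has been set to zero.\<close>
  have "finite T \<Longrightarrow> T \<subseteq> lists S \<Longrightarrow> {w. p w \<noteq> 0} \<subseteq> T \<Longrightarrow> P p" for T and p :: "'a list \<Rightarrow> complex"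
  proof (induction T arbitrary: p rule: finite_induct)
    case empty
    \<comment> \<open>No case of the rule treats zero by itself; it is reached as the zero multiple
      of a monomial.\<close>
    then have "p = 0 \<odot>\<^bsub>free_algebra S\<^esub> monomial []"
      by (auto simp: free_algebra_simps)
    then show ?case using smult[OF monomial_closed monomial] by simp
  next
    case (insert w T)
    let ?q = "p(w := 0)"
    have w: "w \<in> lists S" and T: "T \<subseteq> lists S" using insert.prems by auto
    have q: "{x. ?q x \<noteq> 0} \<subseteq> T" using insert.prems by auto
    then have "?q \<in> carrier (free_algebra S)"
      using insert.hyps(1) T finite_subset unfolding free_algebra_simps by blast
    moreover have "P ?q" by (rule insert.IH[OF T q])
    moreover have "p = ?q \<oplus>\<^bsub>free_algebra S\<^esub> (p w \<odot>\<^bsub>free_algebra S\<^esub> monomial w)"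
      by (auto simp: free_algebra_simps monomial_def)
    ultimately show ?case
      by (metis add smult monomial monomial_closed free_smult_closed w)
  qed
  from this[of "{w. p w \<noteq> 0}" p] assms(1) show ?thesis by (simp add: free_algebra_simps)
qed

section \<open>Algebra homomorphisms, quotients and universal properties\<close>

lemma alg_homD:
  assumes "h \<in> alg_hom A B"
  shows "h \<in> ring_hom A B" "h \<in> extensional (carrier A)"
    "\<And>x. x \<in> carrier A \<Longrightarrow> h x \<in> carrier B"
    "\<And>x y. \<lbrakk>x \<in> carrier A; y \<in> carrier A\<rbrakk> \<Longrightarrow> h (x \<otimes>\<^bsub>A\<^esub> y) = h x \<otimes>\<^bsub>B\<^esub> h y"
    "\<And>x y. \<lbrakk>x \<in> carrier A; y \<in> carrier A\<rbrakk> \<Longrightarrow> h (x \<oplus>\<^bsub>A\<^esub> y) = h x \<oplus>\<^bsub>B\<^esub> h y"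
    "h \<one>\<^bsub>A\<^esub> = \<one>\<^bsub>B\<^esub>"
    "\<And>c x. x \<in> carrier A \<Longrightarrow> h (c \<odot>\<^bsub>A\<^esub> x) = c \<odot>\<^bsub>B\<^esub> h x"
  using assms by (auto simp: alg_hom_def ring_hom_def)

lemma alg_homI:
  assumes "h \<in> extensional (carrier A)"
    "\<And>x. x \<in> carrier A \<Longrightarrow> h x \<in> carrier B"
    "\<And>x y. \<lbrakk>x \<in> carrier A; y \<in> carrier A\<rbrakk> \<Longrightarrow> h (x \<otimes>\<^bsub>A\<^esub> y) = h x \<otimes>\<^bsub>B\<^esub> h y"
    "\<And>x y. \<lbrakk>x \<in> carrier A; y \<in> carrier A\<rbrakk> \<Longrightarrow> h (x \<oplus>\<^bsub>A\<^esub> y) = h x \<oplus>\<^bsub>B\<^esub> h y"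
    "h \<one>\<^bsub>A\<^esub> = \<one>\<^bsub>B\<^esub>"
    "\<And>c x. x \<in> carrier A \<Longrightarrow> h (c \<odot>\<^bsub>A\<^esub> x) = c \<odot>\<^bsub>B\<^esub> h x"
  shows "h \<in> alg_hom A B"
  using assms by (auto simp: alg_hom_def ring_hom_def)

context complex_algebra
begin

section \<open>Quotient of an algebra by a two-sided ideal\<close>

context
  fixes I assumes I: "ideal I A"
begin

interpretation I: ideal I A by (rule I)

lemma coset_eq_iff:
  "\<lbrakk>x \<in> carrier A; y \<in> carrier A\<rbrakk> \<Longrightarrow> I +> x = I +> y \<longleftrightarrow> x \<ominus> y \<in> I"
  using quotient_eq_iff_same_a_r_cos[OF I, of x y] by simp

text \<open>Scalar multiplication on the quotient is defined as a union over all representatives.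
  Two representatives differ by some \<open>h\<close> in \<open>I\<close>, their multiples by
  \<open>c \<odot> h\<close>, again in \<open>I\<close>; so all cosets in the union
  coincide.\<close>

lemma coset_smult:
  assumes x: "x \<in> carrier A" shows "(\<Union>z\<in>I +> x. I +> (c \<odot> z)) = I +> (c \<odot> x)"
proof -
  have "I +> (c \<odot> z) = I +> (c \<odot> x)" if z: "z \<in> I +> x" for z
  proof -
    obtain h where h: "h \<in> I" "z = h \<oplus> x" using z by (auto simp: a_r_coset_def')
    then have "c \<odot> z \<ominus> c \<odot> x = c \<odot> h"
      using x I.a_Hcarr[of h] by (simp add: V.smult_r_distr a_minus_def a_assoc r_neg)
    moreover have "c \<odot> h \<in> I" by (rule ideal_smult_closed[OF I h(1)])
    ultimately show ?thesis using x h I.a_Hcarr[of h] by (subst coset_eq_iff) auto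
  qed
  moreover have "x \<in> I +> x" using x by (rule I.a_rcos_self)
  ultimately show ?thesis by blast
qed

lemma coset_closed: "x \<in> carrier A \<Longrightarrow> I +> x \<in> carrier (quot_algebra A I)"
  by (auto simp: quot_algebra_def FactRing_def A_RCOSETS_def')

lemma quot_algebra_cases:
  assumes "K \<in> carrier (quot_algebra A I)"
  obtains x where "x \<in> carrier A" "K = I +> x"
  using assms by (auto simp: quot_algebra_def FactRing_def A_RCOSETS_def')

lemma quot_algebra_simps:
  "\<lbrakk>x \<in> carrier A; y \<in> carrier A\<rbrakk> \<Longrightarrow> (I +> x) \<otimes>\<^bsub>quot_algebra A I\<^esub> (I +> y) = I +> (x \<otimes> y)"
  "\<lbrakk>x \<in> carrier A; y \<in> carrier A\<rbrakk> \<Longrightarrow> (I +> x) \<oplus>\<^bsub>quot_algebra A I\<^esub> (I +> y) = I +> (x \<oplus> y)"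
  "x \<in> carrier A \<Longrightarrow> c \<odot>\<^bsub>quot_algebra A I\<^esub> (I +> x) = I +> (c \<odot> x)"
  "\<one>\<^bsub>quot_algebra A I\<^esub> = I +> \<one>"
  "\<zero>\<^bsub>quot_algebra A I\<^esub> = I +> \<zero>"
proof -
  show "\<zero>\<^bsub>quot_algebra A I\<^esub> = I +> \<zero>"
    using I.a_subset by (simp add: quot_algebra_def FactRing_def)
qed (simp_all add: quot_algebra_def FactRing_def I.rcoset_mult_add I.a_rcos_sum coset_smult)

lemma quot_algebra_complex_algebra: "complex_algebra (quot_algebra A I)"
proof -
  note simps = coset_closed quot_algebra_simps
  have ab: "abelian_group (quot_algebra A I)"
  proof (rule abelian_groupI)
    fix K assume "K \<in> carrier (quot_algebra A I)"
    then obtain x where x: "x \<in> carrier A" "K = I +> x" by (rule quot_algebra_cases)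
    then have "(I +> (\<ominus> x)) \<oplus>\<^bsub>quot_algebra A I\<^esub> K = \<zero>\<^bsub>quot_algebra A I\<^esub>"
      by (simp add: simps l_neg)
    then show "\<exists>L\<in>carrier (quot_algebra A I). L \<oplus>\<^bsub>quot_algebra A I\<^esub> K = \<zero>\<^bsub>quot_algebra A I\<^esub>"
      using x(1) by (intro bexI[where x = "I +> (\<ominus> x)"]) (simp_all add: simps)
  qed ((elim quot_algebra_cases)?; simp add: simps a_ac)+
  have "Group.monoid (quot_algebra A I)"
    by (rule monoidI; (elim quot_algebra_cases)?; simp add: simps m_assoc)
  with ab have "ring (quot_algebra A I)"
    by (intro ringI; (elim quot_algebra_cases)?; simp add: simps l_distr r_distr)
  moreover have "module complex_field (quot_algebra A I)"
    using ab by (intro moduleI; (elim quot_algebra_cases)?;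
      simp add: simps cring_from_type_algebra V.smult_l_distr[simplified] V.smult_r_distr
        V.smult_assoc1[simplified] V.smult_one[simplified])
  ultimately show ?thesis
    by (intro complex_algebra.intro complex_algebra_axioms.intro; (elim quot_algebra_cases)?;
      simp add: simps smult_mult_left smult_mult_right)
qed

lemma quot_algebra_lift:
  assumes f: "f \<in> alg_hom A B" and zero: "\<And>x. x \<in> I \<Longrightarrow> f x = \<zero>\<^bsub>B\<^esub>" and B: "complex_algebra B"
  shows "\<exists>\<phi>\<in>alg_hom (quot_algebra A I) B. \<forall>x\<in>carrier A. \<phi> (I +> x) = f x"
proof -
  interpret B: complex_algebra B by (rule B)
  note simps = coset_closed quot_algebra_simps
  \<comment> \<open>As \<open>f\<close> vanishes on \<open>I\<close>, it is constant on each coset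
    \<open>K\<close>, so the image of \<open>K\<close> is a singleton and \<open>the_elem\<close>
    extracts the common value without a choice of representative.\<close>
  define \<phi> where "\<phi> = (\<lambda>K\<in>carrier (quot_algebra A I). the_elem (f ` K))"
  have \<phi>: "\<phi> (I +> x) = f x" if x: "x \<in> carrier A" for x
  proof -
    have "f z = f x" if z: "z \<in> I +> x" for z
    proof -
      obtain h where h: "h \<in> I" "z = h \<oplus> x" using z by (auto simp: a_r_coset_def')
      then show ?thesis
        using x I.a_Hcarr[OF h(1)] alg_homD(3,5)[OF f] by (simp add: zero)
    qed
    then have "f ` (I +> x) = {f x}" using I.a_rcos_self[OF x] by blast
    then show ?thesis using x by (simp add: \<phi>_def simps)
  qed
  have "\<phi> \<in> alg_hom (quot_algebra A I) B"
  proof (rule alg_homI)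
    show "\<phi> \<in> extensional (carrier (quot_algebra A I))"
      by (simp add: \<phi>_def)
  qed ((elim quot_algebra_cases)?; simp add: simps \<phi> alg_homD[OF f])+
  then show ?thesis using \<phi> by blast
qed

end

text \<open>It suffices to test a homomorphism on the relators: its kernel is an ideal, and
  \<open>Idl R\<close> is the least ideal containing \<open>R\<close>.\<close>

lemma Idl_le_kernel:
  assumes f: "f \<in> alg_hom A B" and B: "complex_algebra B"
    and R: "R \<subseteq> carrier A" "\<And>x. x \<in> R \<Longrightarrow> f x = \<zero>\<^bsub>B\<^esub>" and x: "x \<in> Idl R"
  shows "f x = \<zero>\<^bsub>B\<^esub>"
proof -
  interpret B: complex_algebra B by (rule B)
  interpret f: ring_hom_ring A B f
    by (rule ring_hom_ringI2[OF ring_axioms B.ring_axioms alg_homD(1)[OF f]])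
  have "R \<subseteq> a_kernel A B f"
    using R unfolding a_kernel_def' by blast
  then have "Idl R \<subseteq> a_kernel A B f"
    by (rule genideal_minimal[OF f.kernel_is_ideal])
  then show ?thesis using x unfolding a_kernel_def' by blast
qed

text \<open>Here the ambient algebra \<open>A\<close> is the target. The map is extended
  multiplicatively to words by \<open>e\<close>, then linearly to coefficient functions by
  \<open>f\<close>.\<close>

lemma free_algebra_lift:
  fixes \<pi> :: "'g \<Rightarrow> 'a"
  assumes \<pi>: "\<And>g. g \<in> S \<Longrightarrow> \<pi> g \<in> carrier A"
  shows "\<exists>f\<in>alg_hom (free_algebra S) A. \<forall>g\<in>S. f (free_gen g) = \<pi> g"
proof -
  let ?F = "free_algebra S"
  interpret F: complex_algebra ?F by (rule free_algebra_complex_algebra)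
  define e where "e w = foldr (\<lambda>g b. \<pi> g \<otimes> b) w \<one>" for w
  define f where "f = (\<lambda>p\<in>carrier ?F. \<Oplus>w\<in>{w. p w \<noteq> 0}. p w \<odot> e w)"
  have e: "e w \<in> carrier A" if "w \<in> lists S" for w
    using that by (induction w) (auto simp: e_def \<pi>)
  have e_append: "e (u @ v) = e u \<otimes> e v" if "u \<in> lists S" "v \<in> lists S" for u v
    using that(1)
  proof (induction u)
    case (Cons g u)
    then show ?case using e[of u] e[of v] that(2) \<pi>[of g] by (simp add: e_def m_assoc)
  qed (use e[OF that(2)] in \<open>simp add: e_def\<close>)
  \<comment> \<open>Supports change under addition and scaling. Summing over any finite
    \<open>T\<close> above the support, where the extra terms are zero multiples, allows sums to be
    compared over one index set.\<close>
  have f_eq: "f p = (\<Oplus>w\<in>T. p w \<odot> e w)"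
    if "p \<in> carrier ?F" "finite T" "T \<subseteq> lists S" "{w. p w \<noteq> 0} \<subseteq> T" for p T
  proof -
    have "(\<Oplus>w\<in>{w. p w \<noteq> 0}. p w \<odot> e w) = (\<Oplus>w\<in>T. p w \<odot> e w)"
    proof (rule add.finprod_mono_neutral_cong_left)
      fix w assume "w \<in> T - {w. p w \<noteq> 0}"
      then show "p w \<odot> e w = \<zero>"
        using V.smult_l_null[OF e] that(3) by auto
    next
      show "(\<lambda>w. p w \<odot> e w) \<in> T \<rightarrow> carrier A"
        using that(3) by (intro Pi_I V.smult_closed e) auto
    qed (use that in simp_all)
    then show ?thesis using that(1) by (simp add: f_def)
  qed
  have e_finsupp: "e w \<in> carrier A" if "p \<in> carrier ?F" "p w \<noteq> 0" for p w
    using that by (intro e) (auto simp: free_algebra_simps)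
  have f_closed: "f p \<in> carrier A" if "p \<in> carrier ?F" for p
    using that e_finsupp[OF that] by (simp add: f_def)
  have f_add: "f (p \<oplus>\<^bsub>?F\<^esub> q) = f p \<oplus> f q" if p: "p \<in> carrier ?F" and q: "q \<in> carrier ?F" for p q
  proof -
    let ?T = "{w. p w \<noteq> 0} \<union> {w. q w \<noteq> 0}"
    have T: "finite ?T" "?T \<subseteq> lists S" using p q by (auto simp: free_algebra_simps)
    have eT: "e w \<in> carrier A" if "w \<in> ?T" for w
      using that e_finsupp[OF p] e_finsupp[OF q] by blast
    have "f (p \<oplus>\<^bsub>?F\<^esub> q) = (\<Oplus>w\<in>?T. (p \<oplus>\<^bsub>?F\<^esub> q) w \<odot> e w)"
      by (rule f_eq[OF F.a_closed[OF p q] T]) (auto simp: free_algebra_simps)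
    also have "\<dots> = (\<Oplus>w\<in>?T. p w \<odot> e w \<oplus> q w \<odot> e w)"
      by (rule finsum_cong') (use eT in \<open>auto simp: free_algebra_simps V.smult_l_distr[simplified]\<close>)
    also have "\<dots> = (\<Oplus>w\<in>?T. p w \<odot> e w) \<oplus> (\<Oplus>w\<in>?T. q w \<odot> e w)"
      by (rule finsum_addf) (use eT in auto)
    also have "\<dots> = f p \<oplus> f q"
      by (simp only: f_eq[OF p T Un_upper1] f_eq[OF q T Un_upper2])
    finally show ?thesis .
  qed
  have f_smult: "f (c \<odot>\<^bsub>?F\<^esub> p) = c \<odot> f p" if p: "p \<in> carrier ?F" for c p
  proof -
    let ?T = "{w. p w \<noteq> 0}"
    have T: "finite ?T" "?T \<subseteq> lists S" using p by (simp_all add: free_algebra_simps)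
    note eT = e_finsupp[OF p]
    \<comment> \<open>For \<open>c = 0\<close> the support of the argument shrinks; the sum is
      therefore kept over the support of \<open>p\<close>.\<close>
    have "f (c \<odot>\<^bsub>?F\<^esub> p) = (\<Oplus>w\<in>?T. (c \<odot>\<^bsub>?F\<^esub> p) w \<odot> e w)"
      by (rule f_eq[OF free_smult_closed[OF p] T]) (auto simp: free_algebra_simps)
    also have "\<dots> = (\<Oplus>w\<in>?T. c \<odot> (p w \<odot> e w))"
      by (rule finsum_cong') (use eT in \<open>auto simp: free_algebra_simps V.smult_assoc1[simplified]\<close>)
    also have "\<dots> = c \<odot> (\<Oplus>w\<in>?T. p w \<odot> e w)"
      by (rule V.finsum_smult_ldistr[symmetric]) (use T(1) eT in auto)
    also have "\<dots> = c \<odot> f p"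
      by (simp only: f_eq[OF p T subset_refl])
    finally show ?thesis .
  qed
  have f_monomial: "f (monomial w) = e w" if w: "w \<in> lists S" for w
  proof -
    have "f (monomial w) = (\<Oplus>x\<in>{w}. monomial w x \<odot> e x)"
      by (rule f_eq[OF monomial_closed[OF w]]) (use w in \<open>simp_all add: monomial_def\<close>)
    also have "\<dots> = monomial w w \<odot> e w"
      using e[OF w] by (subst finsum_insert) auto
    also have "\<dots> = e w"
      using V.smult_one[OF e[OF w]] by (simp add: monomial_def)
    finally show ?thesis .
  qed
  \<comment> \<open>Both sides are bilinear in \<open>p\<close> and \<open>q\<close>, which reduces
    the claim to two monomials; there it is \<open>e_append\<close>.\<close>
  have f_mult: "f (p \<otimes>\<^bsub>?F\<^esub> q) = f p \<otimes> f q" if p: "p \<in> carrier ?F" and q: "q \<in> carrier ?F" for p q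
    using p
  proof (induction p rule: free_algebra_induct)
    case (monomial u)
    show ?case using q
    proof (induction q rule: free_algebra_induct)
      case (monomial v)
      then show ?case using \<open>u \<in> lists S\<close>
        by (simp add: monomial_mult f_monomial e_append)
    qed (simp_all add: monomial F.r_distr F.smult_mult_right monomial_closed f_add f_smult f_closed
        r_distr smult_mult_right)
  qed (simp_all add: q F.l_distr F.smult_mult_left f_add f_smult f_closed l_distr smult_mult_left)
  have "f \<one>\<^bsub>?F\<^esub> = \<one>"
    using f_monomial[of "[]"] by (simp add: free_algebra_simps(3) e_def)
  moreover have "f \<in> extensional (carrier ?F)" by (simp add: f_def)
  ultimately have "f \<in> alg_hom ?F A"
    by (intro alg_homI) (simp_all add: f_closed f_add f_mult f_smult)
  moreover have "f (free_gen g) = \<pi> g" if "g \<in> S" for g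
    using f_monomial[of "[g]"] that \<pi> by (simp add: free_gen_eq_monomial e_def)
  ultimately show ?thesis by blast
qed

end

section \<open>Endomorphism algebras and modules\<close>

lemma lin_homI:
  assumes "f \<in> extensional (carrier V)"
    "\<And>x. x \<in> carrier V \<Longrightarrow> f x \<in> carrier W"
    "\<And>x y. \<lbrakk>x \<in> carrier V; y \<in> carrier V\<rbrakk> \<Longrightarrow> f (x \<oplus>\<^bsub>V\<^esub> y) = f x \<oplus>\<^bsub>W\<^esub> f y"
    "\<And>c x. x \<in> carrier V \<Longrightarrow> f (c \<odot>\<^bsub>V\<^esub> x) = c \<odot>\<^bsub>W\<^esub> f x"
  shows "f \<in> lin_hom V W"
  using assms by (auto simp: lin_hom_def PiE_def)

lemma lin_homD:
  assumes "f \<in> lin_hom V W"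
  shows "f \<in> extensional (carrier V)"
    "\<And>x. x \<in> carrier V \<Longrightarrow> f x \<in> carrier W"
    "\<And>x y. \<lbrakk>x \<in> carrier V; y \<in> carrier V\<rbrakk> \<Longrightarrow> f (x \<oplus>\<^bsub>V\<^esub> y) = f x \<oplus>\<^bsub>W\<^esub> f y"
    "\<And>c x. x \<in> carrier V \<Longrightarrow> f (c \<odot>\<^bsub>V\<^esub> x) = c \<odot>\<^bsub>W\<^esub> f x"
  using assms by (auto simp: lin_hom_def PiE_def)

lemma lin_hom_eqI:
  assumes "f \<in> lin_hom V W" "g \<in> lin_hom V W" "\<And>v. v \<in> carrier V \<Longrightarrow> f v = g v"
  shows "f = g"
  using assms by (intro extensionalityI[of f "carrier V" g]) (auto dest: lin_homD(1))

lemma lin_hom_compose: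
  assumes "f \<in> lin_hom U V" "g \<in> lin_hom V W" "module complex_field U"
  shows "compose (carrier U) g f \<in> lin_hom U W"
proof -
  interpret U: module complex_field U by fact
  show ?thesis
    by (rule lin_homI) (simp_all add: compose_def lin_homD[OF assms(1)] lin_homD[OF assms(2)])
qed

lemma lin_hom_id:
  assumes "module complex_field V" shows "(\<lambda>v\<in>carrier V. v) \<in> lin_hom V V"
proof -
  interpret V: module complex_field V by fact
  show ?thesis by (rule lin_homI) simp_all
qed

lemma End_alg_simps:
  "carrier (End_alg V) = lin_hom V V"
  "f \<otimes>\<^bsub>End_alg V\<^esub> g = compose (carrier V) f g"
  "\<one>\<^bsub>End_alg V\<^esub> = (\<lambda>v\<in>carrier V. v)"
  "\<zero>\<^bsub>End_alg V\<^esub> = (\<lambda>v\<in>carrier V. \<zero>\<^bsub>V\<^esub>)"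
  "f \<oplus>\<^bsub>End_alg V\<^esub> g = (\<lambda>v\<in>carrier V. f v \<oplus>\<^bsub>V\<^esub> g v)"
  "c \<odot>\<^bsub>End_alg V\<^esub> f = (\<lambda>v\<in>carrier V. c \<odot>\<^bsub>V\<^esub> f v)"
  by (simp_all add: End_alg_def)

lemma End_alg_complex_algebra:
  assumes V: "module complex_field V" shows "complex_algebra (End_alg V)"
proof -
  interpret V: module complex_field V by fact
  let ?E = "End_alg V"
  note vs = V.smult_l_distr[simplified] V.smult_r_distr[simplified] V.smult_assoc1[simplified]
    V.smult_one[simplified]
  have add: "f \<oplus>\<^bsub>?E\<^esub> g \<in> carrier ?E" if "f \<in> carrier ?E" "g \<in> carrier ?E" for f g
    using that unfolding End_alg_simps
    by (intro lin_homI) (simp_all add: lin_homD vs V.a_ac)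
  have smult: "c \<odot>\<^bsub>?E\<^esub> f \<in> carrier ?E" if "f \<in> carrier ?E" for c f
    using that unfolding End_alg_simps
    by (intro lin_homI) (simp_all add: lin_homD vs[symmetric] mult.commute)
  have zero: "\<zero>\<^bsub>?E\<^esub> \<in> carrier ?E"
    unfolding End_alg_simps by (intro lin_homI) simp_all
  have one: "\<one>\<^bsub>?E\<^esub> \<in> carrier ?E"
    unfolding End_alg_simps by (rule lin_hom_id[OF V])
  have mult: "f \<otimes>\<^bsub>?E\<^esub> g \<in> carrier ?E" if "f \<in> carrier ?E" "g \<in> carrier ?E" for f g
    using that unfolding End_alg_simps by (intro lin_hom_compose V)
  note closed = add smult zero one mult
  have eqI: "f = g" if "f \<in> carrier ?E" "g \<in> carrier ?E" "\<And>v. v \<in> carrier V \<Longrightarrow> f v = g v" for f g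
    using that lin_hom_eqI[of f V V g] by (simp add: End_alg_simps)
  have app: "f v \<in> carrier V" "(f \<otimes>\<^bsub>?E\<^esub> g) v = f (g v)" "(f \<oplus>\<^bsub>?E\<^esub> g) v = f v \<oplus>\<^bsub>V\<^esub> g v"
      "(c \<odot>\<^bsub>?E\<^esub> f) v = c \<odot>\<^bsub>V\<^esub> f v"
      "w \<in> carrier V \<Longrightarrow> f (v \<oplus>\<^bsub>V\<^esub> w) = f v \<oplus>\<^bsub>V\<^esub> f w" "f (c \<odot>\<^bsub>V\<^esub> v) = c \<odot>\<^bsub>V\<^esub> f v"
    if "f \<in> carrier ?E" "v \<in> carrier V" for f g v w c
    using that by (simp_all add: End_alg_simps compose_def lin_homD)
  have app0: "\<one>\<^bsub>?E\<^esub> v = v" "\<zero>\<^bsub>?E\<^esub> v = \<zero>\<^bsub>V\<^esub>" if "v \<in> carrier V" for v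
    using that by (simp_all add: End_alg_simps)
  have ab: "abelian_group ?E"
  proof (rule abelian_groupI)
    fix f assume f: "f \<in> carrier ?E"
    \<comment> \<open>The additive inverse of \<open>f\<close> is taken to be its multiple by -1,
      which is already known to be linear.\<close>
    have "(- 1) \<odot>\<^bsub>V\<^esub> x \<oplus>\<^bsub>V\<^esub> x = \<zero>\<^bsub>V\<^esub>" if "x \<in> carrier V" for x
      using vs(1)[of x "-1" 1] V.smult_l_null[of x] that by (simp add: vs)
    then have "((- 1) \<odot>\<^bsub>?E\<^esub> f) \<oplus>\<^bsub>?E\<^esub> f = \<zero>\<^bsub>?E\<^esub>"
      using f by (intro eqI) (simp_all add: closed app app0)
    then show "\<exists>g\<in>carrier ?E. g \<oplus>\<^bsub>?E\<^esub> f = \<zero>\<^bsub>?E\<^esub>"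
      using smult[OF f] by blast
  qed (simp_all add: closed, auto intro!: eqI simp: closed app app0 V.a_ac)
  have monoid: "Group.monoid ?E"
    by (rule monoidI) (simp_all add: closed, auto intro!: eqI simp: closed app app0)
  have "ring ?E"
    by (rule ringI) (simp_all add: ab monoid, auto intro!: eqI simp: closed app app0)
  moreover have "module complex_field ?E"
    by (rule moduleI) (simp_all add: ab cring_from_type_algebra closed,
      auto intro!: eqI simp: closed app app0 vs)
  ultimately show ?thesis
    by (intro complex_algebra.intro complex_algebra_axioms.intro; simp?)
      (auto intro!: eqI simp: closed app app0)
qed

text \<open>Uncurrying, for any algebra \<open>A\<close>: the homomorphism laws give the module
  axioms in the algebra variable, linearity of the values gives those in the vector variable. The
  next lemma curries back.\<close>

lemma left_module_of_alg_hom: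
  assumes A: "complex_algebra A" and V: "fd_vector_space V" and \<phi>: "\<phi> \<in> alg_hom A (End_alg V)"
  shows "left_module A V (\<lambda>(a, v)\<in>carrier A \<times> carrier V. \<phi> a v)"
proof -
  interpret A: complex_algebra A by (rule A)
  interpret V: module complex_field V using V by (simp add: fd_vector_space_def)
  have lin: "\<phi> a \<in> lin_hom V V" if "a \<in> carrier A" for a
    using alg_homD(3)[OF \<phi> that] by (simp add: End_alg_simps)
  have "(\<lambda>(a, v)\<in>carrier A \<times> carrier V. \<phi> a v) \<in> carrier A \<times> carrier V \<rightarrow>\<^sub>E carrier V"
    by (auto simp: lin_homD(2)[OF lin])
  then show ?thesis
    unfolding left_module_def
    by (simp add: V alg_homD[OF \<phi>] lin_homD[OF lin] End_alg_simps compose_def)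
qed

lemma alg_hom_of_left_module:
  assumes A: "complex_algebra A" and \<mu>: "left_module A V \<mu>"
  shows "(\<lambda>a\<in>carrier A. \<lambda>v\<in>carrier V. \<mu> (a, v)) \<in> alg_hom A (End_alg V)"
proof -
  interpret A: complex_algebra A by (rule A)
  interpret V: module complex_field V using \<mu> by (simp add: left_module_def fd_vector_space_def)
  have cl: "\<mu> (a, v) \<in> carrier V" if "a \<in> carrier A" "v \<in> carrier V" for a v
    using \<mu> that by (auto simp: left_module_def PiE_iff)
  have lin: "(\<lambda>v\<in>carrier V. \<mu> (a, v)) \<in> lin_hom V V" if "a \<in> carrier A" for a
    using \<mu> that by (intro lin_homI) (simp_all add: cl, simp_all add: left_module_def)
  show ?thesis
  proof (rule alg_homI)
    fix a b assume "a \<in> carrier A" "b \<in> carrier A"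
    then show "(\<lambda>a\<in>carrier A. \<lambda>v\<in>carrier V. \<mu> (a, v)) (a \<otimes>\<^bsub>A\<^esub> b) =
      (\<lambda>a\<in>carrier A. \<lambda>v\<in>carrier V. \<mu> (a, v)) a \<otimes>\<^bsub>End_alg V\<^esub> (\<lambda>a\<in>carrier A. \<lambda>v\<in>carrier V. \<mu> (a, v)) b"
      "(\<lambda>a\<in>carrier A. \<lambda>v\<in>carrier V. \<mu> (a, v)) (a \<oplus>\<^bsub>A\<^esub> b) =
      (\<lambda>a\<in>carrier A. \<lambda>v\<in>carrier V. \<mu> (a, v)) a \<oplus>\<^bsub>End_alg V\<^esub> (\<lambda>a\<in>carrier A. \<lambda>v\<in>carrier V. \<mu> (a, v)) b"
      using \<mu> by (auto simp: End_alg_simps compose_def cl left_module_def intro!: restrict_ext)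
  next
    fix c a assume "a \<in> carrier A"
    then show "(\<lambda>a\<in>carrier A. \<lambda>v\<in>carrier V. \<mu> (a, v)) (c \<odot>\<^bsub>A\<^esub> a) =
      c \<odot>\<^bsub>End_alg V\<^esub> (\<lambda>a\<in>carrier A. \<lambda>v\<in>carrier V. \<mu> (a, v)) a"
      using \<mu> by (auto simp: End_alg_simps left_module_def intro!: restrict_ext)
  next
    show "(\<lambda>a\<in>carrier A. \<lambda>v\<in>carrier V. \<mu> (a, v)) \<one>\<^bsub>A\<^esub> = \<one>\<^bsub>End_alg V\<^esub>"
      using \<mu> by (auto simp: End_alg_simps left_module_def intro!: restrict_ext)
  qed (simp_all add: End_alg_simps lin)
qed

section \<open>The universal property of the partial group algebra\<close>

text \<open>The relations \<open>[1][g] = [g] = [g][1]\<close> are implied by \<open>[1] = 1\<close>.\<close>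

definition satisfies_relations :: "('g, 'b) monoid_scheme \<Rightarrow> 'g set \<Rightarrow> (complex, 'a) module \<Rightarrow> ('g \<Rightarrow> 'a) \<Rightarrow> bool" where
  "satisfies_relations G H B \<pi> \<longleftrightarrow> \<pi> \<in> carrier G \<rightarrow> carrier B \<and> \<pi> \<one>\<^bsub>G\<^esub> = \<one>\<^bsub>B\<^esub> \<and>
     (\<forall>g\<in>carrier G. \<forall>k\<in>carrier G.
        \<pi> (inv\<^bsub>G\<^esub> g) \<otimes>\<^bsub>B\<^esub> \<pi> (g \<otimes>\<^bsub>G\<^esub> k) = \<pi> (inv\<^bsub>G\<^esub> g) \<otimes>\<^bsub>B\<^esub> \<pi> g \<otimes>\<^bsub>B\<^esub> \<pi> k \<and>
        \<pi> (g \<otimes>\<^bsub>G\<^esub> k) \<otimes>\<^bsub>B\<^esub> \<pi> (inv\<^bsub>G\<^esub> k) = \<pi> g \<otimes>\<^bsub>B\<^esub> \<pi> k \<otimes>\<^bsub>B\<^esub> \<pi> (inv\<^bsub>G\<^esub> k)) \<and>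
     (\<forall>h\<in>H. \<pi> h \<otimes>\<^bsub>B\<^esub> \<pi> (inv\<^bsub>G\<^esub> h) = \<one>\<^bsub>B\<^esub>)"

locale group_with_subgroup = group G + H: subgroup H G
  for G :: "('g, 'b) monoid_scheme" and H :: "'g set"
begin

abbreviation "F \<equiv> free_algebra (carrier G)"
abbreviation "A \<equiv> par_algebra G H"
abbreviation "J \<equiv> par_ideal G H"

sublocale F: complex_algebra F
  by (rule free_algebra_complex_algebra)

lemmas gen_closed = free_gen_closed[of _ "carrier G"]

lemma par_relators_closed: "par_relators G H \<subseteq> carrier F"
  unfolding par_relators_def Let_def by (auto simp: gen_closed H.mem_carrier)

lemma par_ideal_ideal: "ideal J F"
  unfolding par_ideal_def by (rule F.genideal_ideal[OF par_relators_closed])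

lemma par_algebra_complex_algebra: "complex_algebra A"
  unfolding par_algebra_def by (rule F.quot_algebra_complex_algebra[OF par_ideal_ideal])

sublocale A: complex_algebra A
  by (rule par_algebra_complex_algebra)

lemmas coset_simps = F.quot_algebra_simps[OF par_ideal_ideal, folded par_algebra_def]

lemma par_gen_closed: "g \<in> carrier G \<Longrightarrow> par_gen G H g \<in> carrier A"
  unfolding par_gen_def par_algebra_def
  by (rule F.coset_closed[OF par_ideal_ideal gen_closed])

text \<open>The algebra is spanned by products of generators. Peeling letters off on the left means
  that the product case has a generator as its left factor, matching the order in which a product
  acts on vectors.\<close>

lemma par_algebra_induct [consumes 1, case_names one gen add smult]:
  assumes "a \<in> carrier A"
    and one: "P \<one>\<^bsub>A\<^esub>"
    and gen: "\<And>g a. \<lbrakk>g \<in> carrier G; a \<in> carrier A; P a\<rbrakk> \<Longrightarrow> P (par_gen G H g \<otimes>\<^bsub>A\<^esub> a)"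
    and add: "\<And>a b. \<lbrakk>a \<in> carrier A; b \<in> carrier A; P a; P b\<rbrakk> \<Longrightarrow> P (a \<oplus>\<^bsub>A\<^esub> b)"
    and smult: "\<And>c a. \<lbrakk>a \<in> carrier A; P a\<rbrakk> \<Longrightarrow> P (c \<odot>\<^bsub>A\<^esub> a)"
  shows "P a"
proof -
  have closed: "J +>\<^bsub>F\<^esub> p \<in> carrier A" if "p \<in> carrier F" for p
    unfolding par_algebra_def using that by (rule F.coset_closed[OF par_ideal_ideal])
  have "P (J +>\<^bsub>F\<^esub> p)" if "p \<in> carrier F" for p
    using that
  proof (induction p rule: free_algebra_induct)
    case (monomial w)
    then show ?case
    proof (induction w)
      case Nil
      then show ?case using one by (simp add: coset_simps free_algebra_simps(3))
    next
      case (Cons g w)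
      then have g: "g \<in> carrier G" and w: "w \<in> lists (carrier G)" by simp_all
      have "J +>\<^bsub>F\<^esub> monomial (g # w) = par_gen G H g \<otimes>\<^bsub>A\<^esub> (J +>\<^bsub>F\<^esub> monomial w)"
        unfolding par_gen_def using coset_simps(1)[OF gen_closed[OF g] monomial_closed[OF w]]
        by (simp add: free_gen_eq_monomial monomial_mult)
      then show ?case using gen[OF g closed[OF monomial_closed[OF w]]] Cons by simp
    qed
  next
    case (add p q)
    then show ?case using assms(4)[of "J +>\<^bsub>F\<^esub> p" "J +>\<^bsub>F\<^esub> q"] by (simp add: closed coset_simps)
  next
    case (smult c p)
    then show ?case using assms(5)[of "J +>\<^bsub>F\<^esub> p" c] by (simp add: closed coset_simps)
  qed
  then show ?thesis
    using assms(1) F.quot_algebra_cases[OF par_ideal_ideal, folded par_algebra_def] by metis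
qed

lemma coset_eqI:
  assumes "p \<in> carrier F" "q \<in> carrier F" "p \<ominus>\<^bsub>F\<^esub> q \<in> par_relators G H"
  shows "J +>\<^bsub>F\<^esub> p = J +>\<^bsub>F\<^esub> q"
  using assms F.coset_eq_iff[OF par_ideal_ideal] F.genideal_self[OF par_relators_closed]
  unfolding par_ideal_def by blast

lemma satisfies_relations_par_gen: "satisfies_relations G H A (par_gen G H)"
proof -
  note [simp] = gen_closed par_gen_def coset_simps
  have rel: "free_gen \<one>\<^bsub>G\<^esub> \<ominus>\<^bsub>F\<^esub> \<one>\<^bsub>F\<^esub> \<in> par_relators G H"
    "\<And>g k. \<lbrakk>g \<in> carrier G; k \<in> carrier G\<rbrakk> \<Longrightarrow> free_gen (inv\<^bsub>G\<^esub> g) \<otimes>\<^bsub>F\<^esub> free_gen g \<otimes>\<^bsub>F\<^esub> free_gen k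
      \<ominus>\<^bsub>F\<^esub> free_gen (inv\<^bsub>G\<^esub> g) \<otimes>\<^bsub>F\<^esub> free_gen (g \<otimes>\<^bsub>G\<^esub> k) \<in> par_relators G H"
    "\<And>g k. \<lbrakk>g \<in> carrier G; k \<in> carrier G\<rbrakk> \<Longrightarrow> free_gen g \<otimes>\<^bsub>F\<^esub> free_gen k \<otimes>\<^bsub>F\<^esub> free_gen (inv\<^bsub>G\<^esub> k)
      \<ominus>\<^bsub>F\<^esub> free_gen (g \<otimes>\<^bsub>G\<^esub> k) \<otimes>\<^bsub>F\<^esub> free_gen (inv\<^bsub>G\<^esub> k) \<in> par_relators G H"
    "\<And>h. h \<in> H \<Longrightarrow> free_gen h \<otimes>\<^bsub>F\<^esub> free_gen (inv\<^bsub>G\<^esub> h) \<ominus>\<^bsub>F\<^esub> free_gen \<one>\<^bsub>G\<^esub> \<in> par_relators G H"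
    unfolding par_relators_def Let_def by blast+
  have "J +>\<^bsub>F\<^esub> free_gen \<one>\<^bsub>G\<^esub> = J +>\<^bsub>F\<^esub> \<one>\<^bsub>F\<^esub>"
    by (rule coset_eqI[OF _ _ rel(1)]) simp_all
  moreover have "J +>\<^bsub>F\<^esub> (free_gen (inv\<^bsub>G\<^esub> g) \<otimes>\<^bsub>F\<^esub> free_gen g \<otimes>\<^bsub>F\<^esub> free_gen k) =
      J +>\<^bsub>F\<^esub> (free_gen (inv\<^bsub>G\<^esub> g) \<otimes>\<^bsub>F\<^esub> free_gen (g \<otimes>\<^bsub>G\<^esub> k))"
      "J +>\<^bsub>F\<^esub> (free_gen g \<otimes>\<^bsub>F\<^esub> free_gen k \<otimes>\<^bsub>F\<^esub> free_gen (inv\<^bsub>G\<^esub> k)) =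
      J +>\<^bsub>F\<^esub> (free_gen (g \<otimes>\<^bsub>G\<^esub> k) \<otimes>\<^bsub>F\<^esub> free_gen (inv\<^bsub>G\<^esub> k))"
    if "g \<in> carrier G" "k \<in> carrier G" for g k
    using that by (intro coset_eqI rel; simp)+
  \<comment> \<open>The relator yields the class of \<open>free_gen \<one>\<close>; the first
    equation turns this into the unit that \<open>satisfies_relations\<close> asks for.\<close>
  moreover have "J +>\<^bsub>F\<^esub> (free_gen h \<otimes>\<^bsub>F\<^esub> free_gen (inv\<^bsub>G\<^esub> h)) = J +>\<^bsub>F\<^esub> free_gen \<one>\<^bsub>G\<^esub>"
    if "h \<in> H" for h
    using that by (intro coset_eqI rel) (simp_all add: H.mem_carrier)
  ultimately show ?thesis
    unfolding satisfies_relations_def using par_gen_closed by (simp add: H.mem_carrier)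
qed

lemma par_algebra_lift:
  fixes B :: "(complex, 'c) module"
  assumes B: "complex_algebra B" and \<pi>: "satisfies_relations G H B \<pi>"
  shows "\<exists>\<phi>\<in>alg_hom A B. \<forall>g\<in>carrier G. \<phi> (par_gen G H g) = \<pi> g"
proof -
  interpret B: complex_algebra B by (rule B)
  have cl: "\<pi> g \<in> carrier B" if "g \<in> carrier G" for g
    using \<pi> that by (auto simp: satisfies_relations_def)
  obtain f where f: "f \<in> alg_hom F B" and f_gen: "\<And>g. g \<in> carrier G \<Longrightarrow> f (free_gen g) = \<pi> g"
    using B.free_algebra_lift[of "carrier G" \<pi>] cl by blast
  interpret f: ring_hom_ring F B f
    by (rule ring_hom_ringI2[OF F.ring_axioms B.ring_axioms alg_homD(1)[OF f]])
  \<comment> \<open>Every relator is a difference, so \<open>f\<close> kills it as soon as its two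
    terms have the same image; these equalities are what \<open>satisfies_relations\<close>
    supplies, with \<open>\<pi> \<one> = \<one>\<close> settling the relators for
    \<open>[1][g]\<close> and \<open>[g][1]\<close>.\<close>
  have diff: "f (p \<ominus>\<^bsub>F\<^esub> q) = \<zero>\<^bsub>B\<^esub>" if "p \<in> carrier F" "q \<in> carrier F" "f p = f q" for p q
    using that by (simp add: F.minus_eq B.r_neg)
  have "f x = \<zero>\<^bsub>B\<^esub>" if "x \<in> par_relators G H" for x
    using that \<pi> unfolding par_relators_def Let_def satisfies_relations_def
    by (auto intro!: diff simp: gen_closed f_gen H.mem_carrier cl)
  then have "f x = \<zero>\<^bsub>B\<^esub>" if "x \<in> J" for x
    using F.Idl_le_kernel[OF f B par_relators_closed] that unfolding par_ideal_def by blast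
  from F.quot_algebra_lift[OF par_ideal_ideal f this B] show ?thesis
    unfolding par_algebra_def[symmetric] par_gen_def using f_gen gen_closed by metis
qed

text \<open>Uniqueness: the elements on which two homomorphisms agree include the unit and are
  closed under every step of the induction over generators.\<close>

lemma par_algebra_hom_eqI:
  assumes "complex_algebra B" "\<phi> \<in> alg_hom A B" "\<psi> \<in> alg_hom A B"
    and "\<And>g. g \<in> carrier G \<Longrightarrow> \<phi> (par_gen G H g) = \<psi> (par_gen G H g)"
  shows "\<phi> = \<psi>"
proof (rule extensionalityI)
  fix a assume "a \<in> carrier A"
  then show "\<phi> a = \<psi> a"
    by (induction a rule: par_algebra_induct)
      (simp_all add: assms(4) alg_homD[OF assms(2)] alg_homD[OF assms(3)] par_gen_closed)
qed (use assms alg_homD(2) in blast)+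

lemma global_partial_rep_iff:
  "global_partial_rep G H V \<pi> \<longleftrightarrow>
     fd_vector_space V \<and> \<pi> \<in> extensional (carrier G) \<and> satisfies_relations G H (End_alg V) \<pi>"
    (is "_ \<longleftrightarrow> ?R")
proof
  assume g: "global_partial_rep G H V \<pi>"
  then have p: "partial_rep G V \<pi>" and h: "restrict \<pi> H \<in> hom (G\<lparr>carrier := H\<rparr>) (units_of (End_alg V))"
    by (auto simp: global_partial_rep_def)
  have "\<pi> h \<otimes>\<^bsub>End_alg V\<^esub> \<pi> (inv\<^bsub>G\<^esub> h) = \<one>\<^bsub>End_alg V\<^esub>" if "h \<in> H" for h
  proof -
    have "restrict \<pi> H (h \<otimes>\<^bsub>G\<^esub> inv\<^bsub>G\<^esub> h) = restrict \<pi> H h \<otimes>\<^bsub>End_alg V\<^esub> restrict \<pi> H (inv\<^bsub>G\<^esub> h)"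
      using hom_mult[OF h, of h "inv\<^bsub>G\<^esub> h"] that by (simp add: units_of_mult)
    then show ?thesis
      using that p by (simp add: H.mem_carrier partial_rep_def)
  qed
  then show ?R using p by (auto simp: partial_rep_def satisfies_relations_def PiE_def)
next
  assume R: ?R
  then interpret E: complex_algebra "End_alg V"
    by (intro End_alg_complex_algebra) (simp add: fd_vector_space_def)
  have p: "partial_rep G V \<pi>" using R by (auto simp: partial_rep_def satisfies_relations_def PiE_def)
  have cl: "\<pi> g \<in> carrier (End_alg V)" if "g \<in> carrier G" for g
    using R that by (auto simp: satisfies_relations_def)
  have inv: "\<pi> h \<otimes>\<^bsub>End_alg V\<^esub> \<pi> (inv\<^bsub>G\<^esub> h) = \<one>\<^bsub>End_alg V\<^esub>" if "h \<in> H" for h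
    using R that by (simp add: satisfies_relations_def)
  \<comment> \<open>\<open>H\<close> is closed under inverses, so the one-sided relation also holds
    at the inverse of \<open>h\<close>. This makes \<open>\<pi> h\<close> a two-sided unit.\<close>
  have inv': "\<pi> (inv\<^bsub>G\<^esub> h) \<otimes>\<^bsub>End_alg V\<^esub> \<pi> h = \<one>\<^bsub>End_alg V\<^esub>" if "h \<in> H" for h
    using inv[of "inv\<^bsub>G\<^esub> h"] that by (simp add: H.mem_carrier)
  \<comment> \<open>The factor \<open>\<pi> (inv h) \<otimes> \<pi> h = \<one>\<close> is inserted
    on the right; next to \<open>\<pi> (inv h)\<close> the partial representation axiom splits
    \<open>\<pi> (g \<otimes> h)\<close>, and the inserted factor cancels. Only \<open>h\<close> has
    to lie in \<open>H\<close>.\<close>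
  have mult: "\<pi> (g \<otimes>\<^bsub>G\<^esub> h) = \<pi> g \<otimes>\<^bsub>End_alg V\<^esub> \<pi> h" if "g \<in> carrier G" "h \<in> H" for g h
  proof -
    note [simp] = H.mem_carrier[OF that(2)] that(1) cl
    have "\<pi> (g \<otimes>\<^bsub>G\<^esub> h) = \<pi> (g \<otimes>\<^bsub>G\<^esub> h) \<otimes>\<^bsub>End_alg V\<^esub> \<pi> (inv\<^bsub>G\<^esub> h) \<otimes>\<^bsub>End_alg V\<^esub> \<pi> h"
      using inv'[OF that(2)] by (simp add: E.m_assoc)
    also have "\<dots> = \<pi> g \<otimes>\<^bsub>End_alg V\<^esub> \<pi> h \<otimes>\<^bsub>End_alg V\<^esub> \<pi> (inv\<^bsub>G\<^esub> h) \<otimes>\<^bsub>End_alg V\<^esub> \<pi> h"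
      using R by (simp add: satisfies_relations_def)
    also have "\<dots> = \<pi> g \<otimes>\<^bsub>End_alg V\<^esub> \<pi> h"
      using inv'[OF that(2)] by (simp add: E.m_assoc)
    finally show ?thesis .
  qed
  have "\<pi> h \<in> Units (End_alg V)" if "h \<in> H" for h
    using inv[OF that] inv'[OF that] cl that unfolding Units_def by (auto simp: H.mem_carrier)
  then have "restrict \<pi> H \<in> hom (G\<lparr>carrier := H\<rparr>) (units_of (End_alg V))"
    by (intro homI) (simp_all add: units_of_carrier units_of_mult mult H.mem_carrier)
  then show "global_partial_rep G H V \<pi>" using p by (simp add: global_partial_rep_def)
qed

text \<open>The generators solve the relations in \<open>A\<close>, and homomorphisms carry
  solutions to solutions. This is the converse of \<open>par_algebra_lift\<close>.\<close>

lemma satisfies_relations_alg_hom: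
  assumes "\<phi> \<in> alg_hom A B"
  shows "satisfies_relations G H B (\<lambda>g\<in>carrier G. \<phi> (par_gen G H g))"
proof -
  note h = alg_homD[OF assms]
  have cl: "par_gen G H g \<in> carrier A" if "g \<in> carrier G" for g
    using that by (rule par_gen_closed)
  note e = satisfies_relations_par_gen[unfolded satisfies_relations_def]
  have 1: "\<phi> (par_gen G H \<one>\<^bsub>G\<^esub>) = \<one>\<^bsub>B\<^esub>" using e h(6) by simp
  have 2: "\<phi> (par_gen G H (inv\<^bsub>G\<^esub> g)) \<otimes>\<^bsub>B\<^esub> \<phi> (par_gen G H (g \<otimes>\<^bsub>G\<^esub> k)) =
      \<phi> (par_gen G H (inv\<^bsub>G\<^esub> g)) \<otimes>\<^bsub>B\<^esub> \<phi> (par_gen G H g) \<otimes>\<^bsub>B\<^esub> \<phi> (par_gen G H k)"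
    "\<phi> (par_gen G H (g \<otimes>\<^bsub>G\<^esub> k)) \<otimes>\<^bsub>B\<^esub> \<phi> (par_gen G H (inv\<^bsub>G\<^esub> k)) =
      \<phi> (par_gen G H g) \<otimes>\<^bsub>B\<^esub> \<phi> (par_gen G H k) \<otimes>\<^bsub>B\<^esub> \<phi> (par_gen G H (inv\<^bsub>G\<^esub> k))"
    if "g \<in> carrier G" "k \<in> carrier G" for g k
    using that e by (simp_all add: h(4)[symmetric] cl)
  have 3: "\<phi> (par_gen G H h) \<otimes>\<^bsub>B\<^esub> \<phi> (par_gen G H (inv\<^bsub>G\<^esub> h)) = \<one>\<^bsub>B\<^esub>" if "h \<in> H" for h
    using that e by (simp add: h(4)[symmetric] h(6) cl H.mem_carrier)
  show ?thesis
    unfolding satisfies_relations_def using 1 2 3 by (simp add: H.mem_carrier h(3) cl)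
qed

end

section \<open>The isomorphism of categories\<close>

lemma fd_vector_space_module: "fd_vector_space V \<Longrightarrow> module complex_field V"
  by (simp add: fd_vector_space_def)

text \<open>Both categories have the same shape: linear maps cut out by a condition \<open>R\<close>
  that is stable under identities and composition. The category laws are thus checked once.\<close>

lemma category_lin_hom:
  fixes Ob :: "((complex, 'v) module \<times> 's) set"
  assumes "\<And>x. x \<in> Ob \<Longrightarrow> module complex_field (fst x)"
    and "\<And>x. x \<in> Ob \<Longrightarrow> R x x (\<lambda>v\<in>carrier (fst x). v)"
    and "\<And>x y z f g. \<lbrakk>x \<in> Ob; y \<in> Ob; z \<in> Ob; f \<in> lin_hom (fst x) (fst y); g \<in> lin_hom (fst y) (fst z);
      R x y f; R y z g\<rbrakk> \<Longrightarrow> R x z (compose (carrier (fst x)) g f)"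
  shows "category \<lparr>cat_obj = Ob, cat_hom = (\<lambda>x y. {f \<in> lin_hom (fst x) (fst y). R x y f}),
    cat_id = (\<lambda>x. \<lambda>v\<in>carrier (fst x). v),
    cat_comp = (\<lambda>x y z g f. compose (carrier (fst x)) g f)\<rparr>"
proof (rule category.intro; clarsimp)
  fix V W s t f
  assume f: "f \<in> lin_hom V W"
  note fD = lin_homD[OF f]
  show "compose (carrier V) (\<lambda>v\<in>carrier W. v) f = f" "compose (carrier V) f (\<lambda>v\<in>carrier V. v) = f"
    by (rule extensionalityI[OF _ fD(1)]; simp add: compose_def fD(2))+
  fix g h
  show "compose (carrier V) h (compose (carrier V) g f) = compose (carrier V) (compose (carrier W) h g) f"
    by (simp add: compose_def fD(2) cong: restrict_cong)
qed (use assms in \<open>fastforce intro: lin_hom_id lin_hom_compose\<close>)+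

context group_with_subgroup
begin

lemma global_partial_rep_ex1_alg_hom:
  assumes "global_partial_rep G H V \<pi>"
  shows "\<exists>!\<phi>. \<phi> \<in> alg_hom A (End_alg V) \<and> (\<forall>g\<in>carrier G. \<phi> (par_gen G H g) = \<pi> g)"
proof -
  have E: "complex_algebra (End_alg V)"
    using assms by (simp add: global_partial_rep_iff End_alg_complex_algebra fd_vector_space_module)
  show ?thesis
    using par_algebra_lift[OF E] par_algebra_hom_eqI[OF E] assms
    by (fastforce simp: global_partial_rep_iff)
qed

lemma phi_of_alg_hom:
  assumes "global_partial_rep G H V \<pi>"
  shows "phi_of G H V \<pi> \<in> alg_hom A (End_alg V)"
    "\<And>g. g \<in> carrier G \<Longrightarrow> phi_of G H V \<pi> (par_gen G H g) = \<pi> g"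
  using theI'[OF global_partial_rep_ex1_alg_hom[OF assms]] by (simp_all add: phi_of_def)

lemma phi_of_eqI:
  assumes "global_partial_rep G H V \<pi>" "\<phi> \<in> alg_hom A (End_alg V)"
    "\<And>g. g \<in> carrier G \<Longrightarrow> \<phi> (par_gen G H g) = \<pi> g"
  shows "phi_of G H V \<pi> = \<phi>"
  using global_partial_rep_ex1_alg_hom[OF assms(1)] phi_of_alg_hom[OF assms(1)] assms(2,3) by blast

lemma left_module_action_of:
  assumes "global_partial_rep G H V \<pi>" shows "left_module A V (action_of G H V \<pi>)"
  unfolding action_of_def using assms
  by (intro left_module_of_alg_hom phi_of_alg_hom par_algebra_complex_algebra) (simp_all add: global_partial_rep_iff)

lemma action_of_par_gen:
  "\<lbrakk>global_partial_rep G H V \<pi>; g \<in> carrier G; v \<in> carrier V\<rbrakk> \<Longrightarrow>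
    action_of G H V \<pi> (par_gen G H g, v) = \<pi> g v"
  by (simp add: action_of_def par_gen_closed phi_of_alg_hom(2))

text \<open>Shows \<open>rep_of\<close> as the curried action evaluated at the generators, the form
  to which \<open>satisfies_relations_alg_hom\<close> applies.\<close>

lemma rep_of_eq:
  "rep_of G H V \<mu> = (\<lambda>g\<in>carrier G. (\<lambda>a\<in>carrier A. \<lambda>v\<in>carrier V. \<mu> (a, v)) (par_gen G H g))"
  by (auto simp: rep_of_def par_gen_closed)

lemma global_partial_rep_rep_of:
  assumes "left_module A V \<mu>" shows "global_partial_rep G H V (rep_of G H V \<mu>)"
  using satisfies_relations_alg_hom[OF alg_hom_of_left_module[OF par_algebra_complex_algebra assms]] assms
  by (simp add: global_partial_rep_iff rep_of_eq left_module_def)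

text \<open>The curried action is a homomorphism with the prescribed values on generators, so by
  uniqueness it is the one described by \<open>phi_of\<close>.\<close>

lemma phi_of_rep_of:
  assumes "left_module A V \<mu>"
  shows "phi_of G H V (rep_of G H V \<mu>) = (\<lambda>a\<in>carrier A. \<lambda>v\<in>carrier V. \<mu> (a, v))"
  using assms
  by (intro phi_of_eqI global_partial_rep_rep_of alg_hom_of_left_module par_algebra_complex_algebra)
    (simp_all add: rep_of_eq)

lemma action_of_rep_of:
  assumes "left_module A V \<mu>" shows "action_of G H V (rep_of G H V \<mu>) = \<mu>"
proof (rule extensionalityI)
  show "\<mu> \<in> extensional (carrier A \<times> carrier V)"
    using assms by (simp add: left_module_def PiE_def)
qed (auto simp: action_of_def phi_of_rep_of[OF assms])

lemma rep_of_action_of: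
  assumes "global_partial_rep G H V \<pi>" shows "rep_of G H V (action_of G H V \<pi>) = \<pi>"
proof (rule extensionalityI)
  show "\<pi> \<in> extensional (carrier G)"
    using assms by (simp add: global_partial_rep_iff)
  fix g assume g: "g \<in> carrier G"
  \<comment> \<open>\<open>rep_of\<close> restricts its values to the carrier; this leaves
    \<open>\<pi> g\<close> unchanged because linear maps are extensional.\<close>
  then have "\<pi> g \<in> lin_hom V V"
    using assms by (auto simp: global_partial_rep_iff satisfies_relations_def End_alg_simps)
  then have "(\<lambda>v\<in>carrier V. \<pi> g v) = \<pi> g"
    by (intro extensional_restrict lin_homD(1))
  then show "rep_of G H V (action_of G H V \<pi>) g = \<pi> g"
    using g by (simp add: rep_of_def action_of_par_gen[OF assms] cong: restrict_cong)
qed (simp add: rep_of_def)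

text \<open>The algebra elements whose action commutes with \<open>f\<close> include the unit and
  are closed under sums, scalar multiples and left multiplication by generators.\<close>

lemma intertwiner_commutes_with_action:
  assumes \<pi>: "global_partial_rep G H V \<pi>" and \<pi>': "global_partial_rep G H W \<pi>'"
    and f: "f \<in> lin_hom V W"
    and comm: "\<And>g. g \<in> carrier G \<Longrightarrow> compose (carrier V) f (\<pi> g) = compose (carrier V) (\<pi>' g) f"
    and a: "a \<in> carrier A" and v: "v \<in> carrier V"
  shows "f (phi_of G H V \<pi> a v) = phi_of G H W \<pi>' a (f v)"
  using a v
proof (induction a arbitrary: v rule: par_algebra_induct)
  case one
  then show ?case
    by (simp add: alg_homD(6)[OF phi_of_alg_hom(1)] \<pi> \<pi>' End_alg_simps lin_homD(2)[OF f])
next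
  case (gen g a)
  have lin: "phi_of G H V \<pi> a \<in> lin_hom V V"
    using alg_homD(3)[OF phi_of_alg_hom(1)[OF \<pi>] gen.hyps(2)] by (simp add: End_alg_simps)
  \<comment> \<open>To be used at \<open>u = phi_of G H V \<pi> a v\<close>, which lies in
    \<open>V\<close> by \<open>lin\<close>; the induction hypothesis then moves \<open>f\<close>
    past \<open>a\<close>.\<close>
  have "f (\<pi> g u) = \<pi>' g (f u)" if "u \<in> carrier V" for u
    using fun_cong[OF comm[OF gen.hyps(1)], of u] that by (simp add: compose_def)
  then show ?case
    using gen by (simp add: alg_homD(4)[OF phi_of_alg_hom(1)] par_gen_closed phi_of_alg_hom(2) \<pi> \<pi>' End_alg_simps
      compose_def lin_homD(2)[OF f] lin_homD(2)[OF lin])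
next
  case (add a b)
  have lin: "phi_of G H V \<pi> a \<in> lin_hom V V" "phi_of G H V \<pi> b \<in> lin_hom V V"
    using alg_homD(3)[OF phi_of_alg_hom(1)[OF \<pi>]] add.hyps by (simp_all add: End_alg_simps)
  show ?case
    using add by (simp add: alg_homD(5)[OF phi_of_alg_hom(1)] \<pi> \<pi>' End_alg_simps
      lin_homD(2,3)[OF f] lin_homD(2)[OF lin(1)] lin_homD(2)[OF lin(2)])
next
  case (smult c a)
  have lin: "phi_of G H V \<pi> a \<in> lin_hom V V"
    using alg_homD(3)[OF phi_of_alg_hom(1)[OF \<pi>]] smult.hyps by (simp add: End_alg_simps)
  show ?case
    using smult by (simp add: alg_homD(7)[OF phi_of_alg_hom(1)] \<pi> \<pi>' End_alg_simps
      lin_homD(2,4)[OF f] lin_homD(2)[OF lin])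
qed

section \<open>The two categories and their hom-sets\<close>

lemma global_partial_rep_lin_hom:
  "\<lbrakk>global_partial_rep G H V \<pi>; g \<in> carrier G\<rbrakk> \<Longrightarrow> \<pi> g \<in> lin_hom V V"
  by (auto simp: global_partial_rep_iff satisfies_relations_def End_alg_simps)

lemma category_PRep: "category (PRep G H)"
proof -
  let ?O = "{x. global_partial_rep G H (fst x) (snd x)}"
  have "category \<lparr>cat_obj = ?O,
    cat_hom = (\<lambda>x y. {f \<in> lin_hom (fst x) (fst y). \<forall>g\<in>carrier G. \<forall>v\<in>carrier (fst x).
      f (snd x g v) = snd y g (f v)}),
    cat_id = (\<lambda>x. \<lambda>v\<in>carrier (fst x). v),
    cat_comp = (\<lambda>x y z g f. compose (carrier (fst x)) g f)\<rparr>"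
    by (intro category_lin_hom)
      (auto simp: compose_def lin_homD(2) lin_homD(2)[OF global_partial_rep_lin_hom],
        simp add: global_partial_rep_iff fd_vector_space_module)
  \<comment> \<open>Equality of the two composites, both restricted to the carrier, is the pointwise
    condition used above.\<close>
  also have "\<dots> = PRep G H"
    by (auto simp: PRep_def fun_eq_iff compose_def restrict_def)
  finally show ?thesis .
qed

lemma category_Left_Mod: "category (Left_Mod A)"
proof -
  let ?O = "{x. left_module A (fst x) (snd x)}"
  have cl: "\<mu> (a, v) \<in> carrier V" if "left_module A V \<mu>" "a \<in> carrier A" "v \<in> carrier V" for V \<mu> a v
    using that by (auto simp: left_module_def PiE_iff)
  have "category \<lparr>cat_obj = ?O,
    cat_hom = (\<lambda>x y. {f \<in> lin_hom (fst x) (fst y). \<forall>a\<in>carrier A. \<forall>v\<in>carrier (fst x).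
      f (snd x (a, v)) = snd y (a, f v)}),
    cat_id = (\<lambda>x. \<lambda>v\<in>carrier (fst x). v),
    cat_comp = (\<lambda>x y z g f. compose (carrier (fst x)) g f)\<rparr>"
    by (intro category_lin_hom) (auto simp: cl compose_def lin_homD(2), simp add: left_module_def fd_vector_space_module)
  also have "\<dots> = Left_Mod A"
    by (auto simp: Left_Mod_def fun_eq_iff)
  finally show ?thesis .
qed

text \<open>From representations to modules, commutation spreads from the generators to the whole
  algebra; conversely, linearity over the algebra is evaluated at the generators.\<close>

lemma PRep_hom_eq_Left_Mod_hom:
  assumes \<pi>: "global_partial_rep G H V \<pi>" and \<pi>': "global_partial_rep G H W \<pi>'"
  shows "cat_hom (PRep G H) (V, \<pi>) (W, \<pi>') =
    cat_hom (Left_Mod A) (V, action_of G H V \<pi>) (W, action_of G H W \<pi>')"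
proof -
  have "(\<forall>g\<in>carrier G. compose (carrier V) f (\<pi> g) = compose (carrier V) (\<pi>' g) f) \<longleftrightarrow>
    (\<forall>a\<in>carrier A. \<forall>v\<in>carrier V. f (action_of G H V \<pi> (a, v)) = action_of G H W \<pi>' (a, f v))"
    (is "?L \<longleftrightarrow> ?R") if f: "f \<in> lin_hom V W" for f
  proof
    assume ?L
    then show ?R
      using intertwiner_commutes_with_action[OF \<pi> \<pi>' f]
      by (simp add: action_of_def lin_homD(2)[OF f])
  next
    assume R: ?R
    have "f (\<pi> g v) = \<pi>' g (f v)" if "g \<in> carrier G" "v \<in> carrier V" for g v
      using bspec[OF bspec[OF R par_gen_closed[OF that(1)]] that(2)] that
      by (simp add: action_of_par_gen[OF \<pi>] action_of_par_gen[OF \<pi>'] lin_homD(2)[OF f])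
    then show ?L
      by (simp add: compose_def cong: restrict_cong)
  qed
  \<comment> \<open>The equivalence is known for linear \<open>f\<close>; \<open>conj_cong\<close>
    makes linearity available while the second conjunct is rewritten.\<close>
  then show ?thesis
    by (simp add: PRep_def Left_Mod_def cong: conj_cong)
qed

lemma Left_Mod_hom_eq_PRep_hom:
  assumes "left_module A V \<mu>" "left_module A W \<mu>'"
  shows "cat_hom (Left_Mod A) (V, \<mu>) (W, \<mu>') =
    cat_hom (PRep G H) (V, rep_of G H V \<mu>) (W, rep_of G H W \<mu>')"
  using PRep_hom_eq_Left_Mod_hom[OF assms[THEN global_partial_rep_rep_of]] assms
  by (simp add: action_of_rep_of)

text \<open>Identities and composites depend only on the underlying spaces, which both functors
  preserve. The functor laws therefore reduce to closure on objects and the equality of hom-sets,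
  and mutual inverseness to \<open>rep_of_action_of\<close> and
  \<open>action_of_rep_of\<close>.\<close>

lemma inverse_isomorphisms_Phi_Psi:
  "inverse_isomorphisms (PRep G H) (Left_Mod A) (Phi_functor G H) (Psi_functor G H)"
proof -
  have obj: "(V, \<pi>) \<in> cat_obj (PRep G H) \<longleftrightarrow> global_partial_rep G H V \<pi>"
    "(V, \<mu>) \<in> cat_obj (Left_Mod A) \<longleftrightarrow> left_module A V \<mu>" for V \<pi> \<mu>
    by (simp_all add: PRep_def Left_Mod_def)
  have id_comp: "cat_id (PRep G H) (V, \<pi>) = (\<lambda>v\<in>carrier V. v)"
    "cat_id (Left_Mod A) (V, \<mu>) = (\<lambda>v\<in>carrier V. v)"
    "cat_comp (PRep G H) (V, \<pi>) y z g f = compose (carrier V) g f"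
    "cat_comp (Left_Mod A) (V, \<mu>) y' z' g f = compose (carrier V) g f" for V \<pi> \<mu> y z y' z' g f
    by (simp_all add: PRep_def Left_Mod_def)
  have "is_functor (PRep G H) (Left_Mod A) (Phi_functor G H)"
    by (intro is_functor.intro is_functor_axioms.intro category_PRep category_Left_Mod)
      (auto simp: Phi_functor_def obj left_module_action_of PRep_hom_eq_Left_Mod_hom id_comp)
  moreover have "is_functor (Left_Mod A) (PRep G H) (Psi_functor G H)"
    by (intro is_functor.intro is_functor_axioms.intro category_PRep category_Left_Mod)
      (auto simp: Psi_functor_def obj global_partial_rep_rep_of Left_Mod_hom_eq_PRep_hom id_comp)
  moreover have "retracts_functor (PRep G H) (Phi_functor G H) (Psi_functor G H)"
    by (auto simp: retracts_functor_def Phi_functor_def Psi_functor_def obj rep_of_action_of)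
  moreover have "retracts_functor (Left_Mod A) (Psi_functor G H) (Phi_functor G H)"
    by (auto simp: retracts_functor_def Phi_functor_def Psi_functor_def obj action_of_rep_of)
  ultimately show ?thesis by (simp add: inverse_isomorphisms_def)
qed

end

theorem theorem3p3:
  fixes G :: "('g, 'b) monoid_scheme" and H :: "'g set"
  assumes "group G" and "finite (carrier G)" and "subgroup H G"
  shows "(\<forall>(V :: (complex, 'v) module) \<pi>. global_partial_rep G H V \<pi> \<longrightarrow>
           (\<exists>!\<phi>. \<phi> \<in> alg_hom (par_algebra G H) (End_alg V) \<and>
              (\<forall>g\<in>carrier G. \<phi> (par_gen G H g) = \<pi> g)) \<and>
           left_module (par_algebra G H) V (action_of G H V \<pi>)) \<and>
         (\<forall>(V :: (complex, 'v) module) \<mu>. left_module (par_algebra G H) V \<mu> \<longrightarrow>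
           global_partial_rep G H V (rep_of G H V \<mu>)) \<and>
         inverse_isomorphisms
           (PRep G H :: ((complex, 'v) module \<times> ('g \<Rightarrow> 'v \<Rightarrow> 'v), 'v \<Rightarrow> 'v) category)
           (Left_Mod (par_algebra G H)) (Phi_functor G H) (Psi_functor G H)"
proof -
  interpret group_with_subgroup G H
    using assms by (intro group_with_subgroup.intro)
  show ?thesis
    using global_partial_rep_ex1_alg_hom left_module_action_of global_partial_rep_rep_of
      inverse_isomorphisms_Phi_Psi by blast
qed

end
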